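(* Let $L=\{(x,y,z)\in\mathbf{Z}^3 : x+y+z=0\}$ be the triangular lattice, and for a primitive vector $\mathbf{u}\in L$ let $M(\mathbf{u})=M(-\mathbf{u})$ be the matching number defined in the context. If $\{\pm\mathbf{u},\pm\mathbf{v},\pm\mathbf{w}\}$ is a lax superbase of $L$, then $(M(\mathbf{u}),M(\mathbf{v}),M(\mathbf{w}))$ is a Markoff triple. Every Markoff triple arises in this fashion. In particular, if $\mathbf{u}$ is a primitive vector of $L$, then $M(\mathbf{u})$ is a Markoff number, and every Markoff number arises in this fashion.
   Context: A Markoff triple is a triple $(x,y,z)$ of positive integers satisfying $x^2+y^2+z^2=3xyz$. A Markoff number is a positive integer that occurs in at least one Markoff triple. A primitive vector $\mathbf{u}$ of a lattice $L$ is one that cannot be written as $k\mathbf{v}$ with $\mathbf{v}\in L$ and $k>1$ an integer. A lax vector $\pm\mathbf{u}$ is a primitive vector defined only up to sign. A lax superbase of a two-dimensional lattice $L$ is a set of three lax vectors $\{\pm\mathbf{u},\pm\mathbf{v},\pm\mathbf{w}\}$ such that $\pm\mathbf{u}\pm\mathbf{v}\pm\mathbf{w}=\mathbf{0}$ for an appropriate choice of signs and any two of $\mathbf{u},\mathbf{v},\mathbf{w}$ form a basis of $L$. The triangular lattice $L$ lies in the plane $x+y+z=0$ of $\mathbf{R}^3$; its shortest non-zero vectors are the six vectors $\pm(1,-1,0),\pm(0,1,-1),\pm(1,0,-1)$. Joining every pair of lattice points that differ by a shortest vector dissects the plane into equilateral triangles with vertices in $L$. Definition of $M(\mathbf{u})$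 for primitive $\mathbf{u}\in L$: if $\mathbf{u}$ is one of the shortest vectors, $M(\mathbf{u})=1$. Otherwise, let $O$ be the origin and $X$ the lattice point with $\vec{OX}=\mathbf{u}$, and consider all the triangles of the dissection that the segment $OX$ passes through (i.e. whose interiors it meets); their union is a polygon triangulated by these triangles. Form the bipartite graph whose black vertices are the lattice points that are vertices of these triangles, whose white vertices are these triangles, and in which a black vertex is joined to a white vertex precisely when the lattice point is one of the three vertices of the triangle. Let $G(\mathbf{u})$ be the graph obtained by deleting the black vertices $O$ and $X$ and all incident edges. Then $M(\mathbf{u})$ is the number of perfect matchings of $G(\mathbf{u})$. *)

theory Defs
  imports "HOL-Analysis.Analysis"
begin

section \<open>Markoff triples and Markoff numbers\<close>

definition markoff_triple :: "nat \<Rightarrow> nat \<Rightarrow> nat \<Rightarrow> bool" where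
  "markoff_triple x y z \<longleftrightarrow>
     x > 0 \<and> y > 0 \<and> z > 0 \<and> x\<^sup>2 + y\<^sup>2 + z\<^sup>2 = 3 * x * y * z"

definition markoff_number :: "nat \<Rightarrow> bool" where
  "markoff_number m \<longleftrightarrow> m > 0 \<and> (\<exists>x y z. markoff_triple x y z \<and> m \<in> {x, y, z})"


section \<open>Lax vectors and lax superbases\<close>

text \<open>A lattice is given as a set of vectors of a real vector space.\<close>

definition primitive_vector :: "'a::real_vector set \<Rightarrow> 'a \<Rightarrow> bool" where
  "primitive_vector L u \<longleftrightarrow>
     u \<in> L \<and> \<not> (\<exists>(k::int) v. k > 1 \<and> v \<in> L \<and> u = of_int k *\<^sub>R v)"

definition lax :: "'a::real_vector \<Rightarrow> 'a set" where
  "lax u = {u, - u}"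

definition lattice_basis :: "'a::real_vector set \<Rightarrow> 'a \<Rightarrow> 'a \<Rightarrow> bool" where
  "lattice_basis L u v \<longleftrightarrow>
     u \<in> L \<and> v \<in> L \<and>
     (\<forall>x\<in>L. \<exists>!c::int \<times> int. x = of_int (fst c) *\<^sub>R u + of_int (snd c) *\<^sub>R v)"

definition lax_superbase :: "'a::real_vector set \<Rightarrow> 'a set set \<Rightarrow> bool" where
  "lax_superbase L S \<longleftrightarrow>
     card S = 3 \<and>
     (\<exists>u v w. S = {lax u, lax v, lax w} \<and>
        primitive_vector L u \<and> primitive_vector L v \<and> primitive_vector L w \<and>
        (\<exists>a\<in>{1, -1}. \<exists>b\<in>{1, -1}. \<exists>c\<in>{1, -1::real}.
            a *\<^sub>R u + b *\<^sub>R v + c *\<^sub>R w = 0) \<and>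
        lattice_basis L u v \<and> lattice_basis L v w \<and> lattice_basis L u w)"


section \<open>The triangular lattice and its dissection of the plane\<close>

definition tri_lattice :: "(real^3) set" where
  "tri_lattice = {p. (\<forall>i. p $ i \<in> \<int>) \<and> p $ 1 + p $ 2 + p $ 3 = 0}"

definition shortest_vectors :: "'a::real_normed_vector set \<Rightarrow> 'a set" where
  "shortest_vectors L = {u \<in> L - {0}. \<forall>v \<in> L - {0}. norm u \<le> norm v}"

lemma shortest_vectors_tri_lattice:
  "shortest_vectors tri_lattice =
     {vector [1, -1, 0], vector [-1, 1, 0], vector [0, 1, -1], vector [0, -1, 1],
      vector [1, 0, -1], vector [-1, 0, 1]}" (is "_ = ?S")
proof -
  have nz: "norm p = sqrt ((p$1)\<^sup>2 + (p$2)\<^sup>2 + (p$3)\<^sup>2)" for p :: "real^3"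
    by (simp add: norm_vec_def L2_set_def sum_3)
  have S1: "p \<in> tri_lattice - {0} \<and> norm p = sqrt 2" if "p \<in> ?S" for p
    using that by (auto simp: tri_lattice_def nz forall_3 vec_eq_iff)
  have S2: "norm p \<ge> sqrt 2 \<and> (norm p = sqrt 2 \<longrightarrow> p \<in> ?S)"
    if p: "p \<in> tri_lattice - {0}" for p
  proof -
    obtain a b where ab: "p$1 = of_int a" "p$2 = of_int b"
      using p by (auto simp: tri_lattice_def elim!: Ints_cases) (metis Ints_cases)
    have c: "p$3 = of_int (- a - b)"
      using p ab by (simp add: tri_lattice_def)
    have nab: "\<not> (a = 0 \<and> b = 0)"
      using p ab c by (auto simp: vec_eq_iff forall_3)
    have eq: "(p$1)\<^sup>2 + (p$2)\<^sup>2 + (p$3)\<^sup>2 = of_int (2 * (a*a + a*b + b*b))"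
      unfolding ab c by (simp add: power2_eq_square algebra_simps)
    have "2 * (a*a + a*b + b*b) = a*a + b*b + (a+b)*(a+b)"
      by (simp add: algebra_simps)
    moreover have "a*a + b*b > 0"
      using nab by (simp add: sum_squares_gt_zero_iff)
    ultimately have "2 * (a*a + a*b + b*b) > 0"
      using zero_le_square[of "a+b"] by linarith
    then have pos: "a*a + a*b + b*b \<ge> 1"
      by (metis int_one_le_iff_zero_less zero_less_mult_pos zero_less_numeral)
    have ge: "norm p \<ge> sqrt 2"
    proof -
      have "2 \<le> 2 * (a*a + a*b + b*b)"
        using pos by (metis mult.right_neutral mult_le_cancel_left_pos zero_less_numeral)
      then have "(2::real) \<le> of_int (2 * (a*a + a*b + b*b))"
        by (metis of_int_le_iff of_int_numeral)
      then show ?thesis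
        unfolding nz eq by (rule real_sqrt_le_mono)
    qed
    have "p \<in> ?S" if "norm p = sqrt 2"
    proof -
      have "(of_int (2 * (a*a + a*b + b*b)) :: real) = 2"
        using that unfolding nz eq by (metis real_sqrt_eq_iff)
      then have "2 * (a*a + a*b + b*b) = 2"
        by (metis of_int_eq_iff of_int_numeral)
      then have s: "a*a + b*b + (a+b)*(a+b) = 2"
        by (simp add: algebra_simps)
      have bound: "\<bar>x\<bar> \<le> 1" if "x * x \<le> (2::int)" for x
      proof (rule ccontr)
        assume "\<not> \<bar>x\<bar> \<le> 1"
        then have "2 * 2 \<le> \<bar>x\<bar> * \<bar>x\<bar>" by (intro mult_mono) auto
        then show False using that by simp
      qed
      have "\<bar>a\<bar> \<le> 1" "\<bar>b\<bar> \<le> 1"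
        using s zero_le_square[of a] zero_le_square[of b] zero_le_square[of "a+b"]
        by (intro bound; linarith)+
      then have "a \<in> {-1, 0, 1}" "b \<in> {-1, 0, 1}" by auto
      then have "(a, b) \<in> {(1,-1), (-1,1), (0,1), (0,-1), (1,0), (-1,0)}"
        using s by auto
      moreover have "p = vector [of_int a, of_int b, of_int (- a - b)]"
        unfolding vec_eq_iff forall_3 by (simp only: ab c vector_3)
      ultimately show ?thesis
        by (elim insertE emptyE) simp_all
    qed
    with ge show ?thesis by blast
  qed
  define q :: "real^3" where "q = vector [1, -1, 0]"
  have q: "q \<in> tri_lattice - {0}" "norm q = sqrt 2"
    using S1[of q] by (simp_all add: q_def)
  show ?thesis
  proof (intro set_eqI iffI)
    fix p assume "p \<in> shortest_vectors tri_lattice"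
    then have p: "p \<in> tri_lattice - {0}" "norm p \<le> norm q"
      using q(1) by (auto simp: shortest_vectors_def)
    then show "p \<in> ?S"
      using S2[OF p(1)] q(2) by linarith
  next
    fix p assume "p \<in> ?S"
    then have "p \<in> tri_lattice - {0}" "norm p = sqrt 2"
      using S1 by blast+
    then show "p \<in> shortest_vectors tri_lattice"
      using S2 by (auto simp: shortest_vectors_def)
  qed
qed

definition dissection_triangle :: "(real^3) set \<Rightarrow> bool" where
  "dissection_triangle T \<longleftrightarrow>
     T \<subseteq> tri_lattice \<and> card T = 3 \<and>
     (\<forall>p\<in>T. \<forall>q\<in>T. p \<noteq> q \<longrightarrow> p - q \<in> shortest_vectors tri_lattice)"

text \<open>A triangle is represented by its set of vertices. Its interior is taken
  within the plane of the lattice, hence the relative interior.\<close>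

definition crossed_triangles :: "real^3 \<Rightarrow> (real^3) set set" where
  "crossed_triangles u =
     {T. dissection_triangle T \<and> closed_segment 0 u \<inter> rel_interior (convex hull T) \<noteq> {}}"


section \<open>Matching numbers\<close>

text \<open>A graph is given by its vertex set and its set of edges, each edge being a
  two-element set of vertices.\<close>

definition perfect_matching :: "'a set \<Rightarrow> 'a set set \<Rightarrow> 'a set set \<Rightarrow> bool" where
  "perfect_matching V E P \<longleftrightarrow> P \<subseteq> E \<and> (\<forall>x\<in>V. \<exists>!e. e \<in> P \<and> x \<in> e)"

type_synonym vertex = "(real^3) + (real^3) set"

text \<open>Black vertices (lattice points) are tagged with \<open>Inl\<close>, white vertices
  (triangles) with \<open>Inr\<close>.\<close>

definition incidence_vertices :: "real^3 \<Rightarrow> vertex set" where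
  "incidence_vertices u = Inl ` (\<Union> (crossed_triangles u)) \<union> Inr ` crossed_triangles u"

definition incidence_edges :: "real^3 \<Rightarrow> vertex set set" where
  "incidence_edges u = {{Inl p, Inr T} |p T. T \<in> crossed_triangles u \<and> p \<in> T}"

definition G_vertices :: "real^3 \<Rightarrow> vertex set" where
  "G_vertices u = incidence_vertices u - {Inl 0, Inl u}"

definition G_edges :: "real^3 \<Rightarrow> vertex set set" where
  "G_edges u = {e \<in> incidence_edges u. Inl 0 \<notin> e \<and> Inl u \<notin> e}"

text \<open>Meaningful only for primitive vectors of the triangular lattice.\<close>

definition matching_number :: "real^3 \<Rightarrow> nat" where
  "matching_number u =
     (if u \<in> shortest_vectors tri_lattice then 1
      else card {P. perfect_matching (G_vertices u) (G_edges u) P})"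

end

theory Submission
  imports Defs
begin

text \<open>
  Write a primitive vector as \<open>u = a e + b f\<close> with \<open>a, b \<ge> 0\<close>, where \<open>e, f\<close> are shortest vectors at an
  angle of 60 degrees. The triangles crossed by \<open>u\<close> pair up to a chain of \<open>a + b - 1\<close> unit cells, and
  matching them one after the other leaves exactly one of the two end points of the last crossed edge
  uncovered. A step of the chain in direction \<open>e\<close> or \<open>f\<close> thus acts on pairs of counts by one of two
  fixed \<open>2 \<times> 2\<close> matrices, so that \<open>M(u)\<close> is the upper right entry of the product \<open>C(u)\<close> of these matrices
  along the Christoffel word of \<open>u\<close>.

  If \<open>u\<close>, \<open>v\<close> is a basis in the sector, with \<open>u\<close> closer to \<open>e\<close>, comparing floors shows that
  \<open>C(u + v) = C(v) C(u)\<close>. Each \<open>C(u)\<close> has determinant 1 and trace \<open>3 M(u)\<close>, so Cayley--Hamilton gives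
  \<open>M(2u + v) = 3 M(u) M(u + v) - M(v)\<close>, which is the Vieta involution that generates all Markoff triples
  from \<open>(1, 1, 2)\<close>. Finally, up to signs every basis of the lattice lies in a single sector.
\<close>

text \<open>In sector coordinates the segment from (0, 0) to (a, b) meets the line x + y = m at
  abscissa m a / (a + b), which for coprime a, b and 0 < m < a + b is not an integer. So the segment
  crosses exactly one antidiagonal edge per level, always in its interior, and the floors of m a /
  (a + b) describe the whole polygon; this is where the Christoffel word comes from. The
  factorization of C(u + v) reflects that no lattice point separates the segment to u + v from the
  path that follows v and then u. One obstacle shapes the last part. The third vector of a superbase
  may be the difference of the other two instead of their sum, and this difference can leave the
  sector even up to sign. That happens only when all three vectors are shortest. Accordingly the
  triple (1, 1, 1) lies outside the tree of sums and is treated by itself.\<close>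

section \<open>Counting perfect matchings\<close>

text \<open>The number of bijections \<open>g\<close> from \<open>{..<N}\<close> onto \<open>V\<close> with \<open>g k \<in> T k\<close> for all \<open>k\<close>.\<close>

fun transversals :: "(nat \<Rightarrow> 'a set) \<Rightarrow> nat \<Rightarrow> 'a set \<Rightarrow> nat" where
  "transversals T 0 V = (if V = {} then 1 else 0)"
| "transversals T (Suc N) V = (\<Sum>p\<in>T N \<inter> V. transversals T N (V - {p}))"

text \<open>A point in none of the sets can never be removed from \<open>V\<close>, so the recursion
  never reaches the empty set. This discards the impossible branches of a count.\<close>

lemma transversals_eq_0:
  assumes "x \<in> V" "\<And>k. k < N \<Longrightarrow> x \<notin> T k"
  shows "transversals T N V = 0"
  using assms
proof (induction N arbitrary: V)
  case (Suc N)
  have "transversals T N (V - {p}) = 0" if "p \<in> T N \<inter> V" for p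
    using Suc.prems that by (intro Suc.IH) auto
  then show ?case by simp
qed auto

lemma transversals_image:
  assumes "inj h"
  shows "transversals (\<lambda>k. h ` T k) N (h ` V) = transversals T N V"
proof (induction N arbitrary: V)
  case (Suc N)
  have "transversals (\<lambda>k. h ` T k) (Suc N) (h ` V) =
      (\<Sum>p\<in>h ` (T N \<inter> V). transversals (\<lambda>k. h ` T k) N (h ` V - {p}))"
    by (simp add: image_Int[OF assms])
  also have "\<dots> = (\<Sum>p\<in>T N \<inter> V. transversals (\<lambda>k. h ` T k) N (h ` (V - {p})))"
    using assms by (subst sum.reindex) (auto intro: inj_on_subset simp: image_set_diff)
  finally show ?case using Suc by simp
qed simp

text \<open>Edges are cut down to the black vertices in \<open>V\<close>, so deleting black vertices
  with their edges, be it O and X or a vertex already matched, is just a smaller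
  \<open>V\<close>.\<close>

definition incidences :: "(nat \<Rightarrow> 'a set) \<Rightarrow> nat \<Rightarrow> 'a set \<Rightarrow> ('a + 'a set) set set" where
  "incidences T N V = {{Inl p, Inr (T k)} |p k. k < N \<and> p \<in> T k \<inter> V}"

text \<open>The white vertex \<open>T N\<close> has exactly one partner p in a perfect matching.
  Removing that edge leaves a perfect matching for the first \<open>N\<close> triangles and
  \<open>V - {p}\<close>, which is the recursion of \<open>transversals\<close>. Injectivity of
  \<open>T\<close> identifies white vertices with indices.\<close>

lemma card_perfect_matchings:
  fixes T :: "nat \<Rightarrow> 'a set"
  assumes "finite V" "\<And>k. k < N \<Longrightarrow> finite (T k)" "inj_on T {..<N}"
  shows "card {P. perfect_matching (Inl ` V \<union> Inr ` T ` {..<N}) (incidences T N V) P} =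
    transversals T N V"
  using assms
proof (induction N arbitrary: V)
  case 0
  have "{P. perfect_matching (Inl ` V \<union> Inr ` T ` {..<0}) (incidences T 0 V) P} =
      (if V = {} then {{}} else {})"
    by (auto simp: perfect_matching_def incidences_def)
  then show ?case by simp
next
  case (Suc N)
  define M where "M N V = {P. perfect_matching (Inl ` V \<union> Inr ` T ` {..<N}) (incidences T N V) P}" for N V
  define e where "e p = {Inl p :: 'a + 'a set, Inr (T N)}" for p
  have TN: "T k \<noteq> T N" if "k < N" for k
    using inj_onD[OF Suc.prems(3), of k N] that by auto
  have fin: "finite (M n W)" if "n \<le> Suc N" for n W
  proof (rule finite_subset)
    show "M n W \<subseteq> Pow (incidences T n W)"
      by (auto simp: M_def perfect_matching_def)
    have "incidences T n W \<subseteq> (\<lambda>(k, p). {Inl p, Inr (T k)}) ` (SIGMA k:{..<n}. T k)"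
      by (auto simp: incidences_def image_iff)
    moreover have "finite (SIGMA k:{..<n}. T k)"
      using Suc.prems(2) that by (intro finite_SigmaI) auto
    ultimately show "finite (Pow (incidences T n W))"
      by (simp add: finite_surj)
  qed
  \<comment> \<open>This makes \<open>insert (e p)\<close> injective on the smaller matchings and
    separates the families that belong to different partners.\<close>
  have e_notin: "e p \<notin> incidences T N W" for p W
  proof
    assume "e p \<in> incidences T N W"
    then obtain k q where k: "k < N" "e p = {Inl q, Inr (T k)}"
      by (auto simp: incidences_def)
    then have "Inr (T k) \<in> e p" by simp
    then show False using TN[OF k(1)] by (simp add: e_def)
  qed
  \<comment> \<open>Matchings are sorted by the partner \<open>p\<close> of the last
    triangle.\<close>
  have eq: "M (Suc N) V = (\<Union>p\<in>T N \<inter> V. insert (e p) ` M N (V - {p}))" (is "_ = ?R")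
  proof (intro set_eqI iffI)
    fix P assume "P \<in> M (Suc N) V"
    then have sub: "P \<subseteq> incidences T (Suc N) V"
      and black: "\<And>p. p \<in> V \<Longrightarrow> \<exists>!e. e \<in> P \<and> Inl p \<in> e"
      and white: "\<And>k. k < Suc N \<Longrightarrow> \<exists>!e. e \<in> P \<and> Inr (T k) \<in> e"
      by (auto simp: M_def perfect_matching_def)
    obtain E where E: "E \<in> P" "Inr (T N) \<in> E"
      using white[of N] by auto
    then obtain p k where p': "p \<in> T k \<inter> V" "E = {Inl p, Inr (T k)}" "k < Suc N"
      using sub by (auto simp: incidences_def)
    then have "T k = T N" using E(2) by auto
    then have p: "p \<in> T N \<inter> V" "E = e p" using p' by (auto simp: e_def)
    define Q where "Q = P - {e p}"
    have other: "x \<notin> F" if "F \<in> Q" "x \<in> e p" for F x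
    proof
      assume "x \<in> F"
      moreover have "F \<in> P" "F \<noteq> e p" "e p \<in> P" "x = Inl p \<or> x = Inr (T N)"
        using that p E by (auto simp: Q_def e_def)
      ultimately show False
        using black[of p] white[of N] p \<open>x \<in> e p\<close> by blast
    qed
    have Q: "Q \<subseteq> incidences T N (V - {p})"
    proof
      fix F assume F: "F \<in> Q"
      then have "F \<in> incidences T (Suc N) V" using sub by (auto simp: Q_def)
      then obtain q k where "F = {Inl q, Inr (T k)}" "k < Suc N" "q \<in> T k \<inter> V"
        by (auto simp: incidences_def)
      moreover have "q \<noteq> p" "k \<noteq> N"
        using other[OF F] calculation by (auto simp: e_def)
      ultimately show "F \<in> incidences T N (V - {p})"
        by (auto simp: incidences_def less_Suc_eq)
    qed
    have "perfect_matching (Inl ` (V - {p}) \<union> Inr ` T ` {..<N}) (incidences T N (V - {p})) Q"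
      unfolding perfect_matching_def
    proof (intro conjI ballI Q)
      fix x assume x: "x \<in> Inl ` (V - {p}) \<union> Inr ` T ` {..<N}"
      then have "x \<notin> e p" using TN by (auto simp: e_def)
      moreover have "\<exists>!F. F \<in> P \<and> x \<in> F"
      proof -
        from x consider q where "x = Inl q" "q \<in> V" | k where "x = Inr (T k)" "k < N"
          by blast
        then show ?thesis by cases (simp_all only: black white less_SucI)
      qed
      ultimately show "\<exists>!F. F \<in> Q \<and> x \<in> F"
        unfolding Q_def by (metis Diff_iff singletonD)
    qed
    moreover have "P = insert (e p) Q"
      using E p by (auto simp: Q_def)
    ultimately show "P \<in> ?R"
      using p by (auto simp: M_def)
  next
    fix P assume "P \<in> ?R"
    then obtain p Q where p: "p \<in> T N" "p \<in> V" "P = insert (e p) Q" "Q \<subseteq> incidences T N (V - {p})"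
      and black: "\<And>q. q \<in> V - {p} \<Longrightarrow> \<exists>!e. e \<in> Q \<and> Inl q \<in> e"
      and white: "\<And>k. k < N \<Longrightarrow> \<exists>!e. e \<in> Q \<and> Inr (T k) \<in> e"
      by (auto simp: M_def perfect_matching_def)
    have other: "x \<notin> F" if "F \<in> Q" "x \<in> e p" for F x
    proof -
      have "F \<in> incidences T N (V - {p})" using \<open>F \<in> Q\<close> p(4) by auto
      then obtain q k where "F = {Inl q, Inr (T k)}" "k < N" "q \<in> V - {p}"
        by (auto simp: incidences_def)
      then show ?thesis using TN \<open>x \<in> e p\<close> by (auto simp: e_def)
    qed
    have "perfect_matching (Inl ` V \<union> Inr ` T ` {..<Suc N}) (incidences T (Suc N) V) P"
      unfolding perfect_matching_def
    proof (intro conjI ballI)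
      show "P \<subseteq> incidences T (Suc N) V"
      proof -
        have "incidences T N (V - {p}) \<subseteq> incidences T (Suc N) V"
          unfolding incidences_def by (auto intro: less_SucI)
        moreover have "e p \<in> incidences T (Suc N) V"
          using p by (auto simp: incidences_def e_def)
        ultimately show ?thesis using p by blast
      qed
      fix x assume x: "x \<in> Inl ` V \<union> Inr ` T ` {..<Suc N}"
      show "\<exists>!F. F \<in> P \<and> x \<in> F"
      proof (cases "x \<in> e p")
        case True
        then show ?thesis using p other by blast
      next
        case False
        from x consider q where "x = Inl q" "q \<in> V" | k where "x = Inr (T k)" "k < Suc N"
          by blast
        then have "\<exists>!F. F \<in> Q \<and> x \<in> F"
        proof cases
          case 1
          then have "q \<in> V - {p}" using False by (auto simp: e_def)
          then show ?thesis unfolding 1 by (rule black)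
        next
          case 2
          then have "k \<noteq> N" using False by (auto simp: e_def)
          then have "k < N" using 2 by simp
          then show ?thesis unfolding 2 by (rule white)
        qed
        then show ?thesis using False p by auto
      qed
    qed
    then show "P \<in> M (Suc N) V" by (simp add: M_def)
  qed
  have inj: "inj_on (insert (e p)) (M N W)" for p W
  proof (rule inj_onI)
    fix P Q assume "P \<in> M N W" "Q \<in> M N W" "insert (e p) P = insert (e p) Q"
    moreover have "e p \<notin> P" "e p \<notin> Q"
      using calculation e_notin[of p W] by (auto simp: M_def perfect_matching_def)
    ultimately show "P = Q" by (metis insert_ident)
  qed
  have disj: "insert (e p) ` M N (V - {p}) \<inter> insert (e q) ` M N (V - {q}) = {}" if "p \<noteq> q" for p q
  proof -
    have "e p \<notin> P" if "P \<in> insert (e q) ` M N (V - {q})" for P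
    proof -
      from that obtain Q where Q: "P = insert (e q) Q" "Q \<in> M N (V - {q})"
        by (rule imageE)
      have "Q \<subseteq> incidences T N (V - {q})"
        using Q(2) by (simp add: M_def perfect_matching_def)
      moreover have "e p \<noteq> e q" using \<open>p \<noteq> q\<close> by (auto simp: e_def doubleton_eq_iff)
      ultimately show ?thesis unfolding Q(1) using e_notin[of p "V - {q}"] by blast
    qed
    moreover have "e p \<in> P" if "P \<in> insert (e p) ` M N (V - {p})" for P
      using that by (elim imageE) simp
    ultimately show ?thesis by (simp only: disjoint_iff) blast
  qed
  have "card (M (Suc N) V) = (\<Sum>p\<in>T N \<inter> V. card (insert (e p) ` M N (V - {p})))"
    unfolding eq using fin disj Suc.prems by (intro card_UN_disjoint) auto
  also have "\<dots> = (\<Sum>p\<in>T N \<inter> V. card (M N (V - {p})))"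
    using inj by (simp add: card_image)
  also have "\<dots> = (\<Sum>p\<in>T N \<inter> V. transversals T N (V - {p}))"
    using Suc.prems unfolding M_def by (intro sum.cong refl Suc.IH) (auto simp: inj_on_def)
  finally show ?case by (simp add: M_def)
qed

section \<open>Cohn matrices\<close>

text \<open>These are transfer matrices acting from the right on a row (ways leaving the lower end
  uncovered, ways leaving the upper end uncovered): \<open>cohn_A\<close> when the column moves on
  by one, \<open>cohn_B\<close> when it stays. Both have determinant 1 and trace 3.\<close>

definition cohn_A :: "int^2^2" where "cohn_A = vector [vector [2, 1], vector [1, 1]]"
definition cohn_B :: "int^2^2" where "cohn_B = vector [vector [1, 1], vector [1, 2]]"

primrec word_matrix :: "(nat \<Rightarrow> bool) \<Rightarrow> nat \<Rightarrow> int^2^2" where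
  "word_matrix h 0 = mat 1"
| "word_matrix h (Suc k) = word_matrix h k ** (if h k then cohn_A else cohn_B)"

lemma word_matrix_add:
  "word_matrix h (k + l) = word_matrix h k ** word_matrix (\<lambda>m. h (k + m)) l"
  by (induction l) (auto simp: matrix_mul_assoc)

lemma word_matrix_cong:
  "(\<And>m. m < k \<Longrightarrow> h m = h' m) \<Longrightarrow> word_matrix h k = word_matrix h' k"
  by (induction k) auto

lemma det_word_matrix: "det (word_matrix h k) = 1"
proof -
  have "det cohn_A = 1" "det cohn_B = 1"
    by (simp_all add: det_2 cohn_A_def cohn_B_def)
  then show ?thesis by (induction k) (simp_all add: det_mul)
qed

text \<open>The floor of m a / n is the column of the m-th cell when n = a + b, so the letter at m
  tells whether the chain of cells changes column between m and m + 1.\<close>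

definition christoffel :: "nat \<Rightarrow> nat \<Rightarrow> nat \<Rightarrow> bool" where
  "christoffel a n m \<longleftrightarrow> m * a div n \<noteq> Suc m * a div n"

definition cohn_matrix :: "nat \<Rightarrow> nat \<Rightarrow> int^2^2" where
  "cohn_matrix a b = word_matrix (christoffel a (a + b)) (a + b)"

section \<open>Factorization of Christoffel words\<close>

context
  fixes a1 n1 a2 n2 :: nat
  assumes det: "a1 * n2 = a2 * n1 + 1" and pos: "n1 > 0" "n2 > 0"
begin

text \<open>By the determinant condition the slope of the sum exceeds a2/n2 by only 1/(n2 (n1 +
  n2)). Up to \<open>m = n2\<close> the line gains at most 1/(n1 + n2) < 1/n2, whereas m a2/n2 stays
  at least 1/n2 below the next integer.\<close>

lemma floor_left:
  assumes "m \<le> n2"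
  shows "m * (a1 + a2) div (n1 + n2) = m * a2 div n2"
proof (rule div_nat_eqI)
  define q where "q = m * a2 div n2"
  have q: "q * n2 \<le> m * a2" "m * a2 + 1 \<le> (q + 1) * n2"
    using pos dividend_less_div_times[of n2 "m * a2"]
    by (auto simp: q_def) 
  have eq: "(m * (a1 + a2)) * n2 = (m * a2) * (n1 + n2) + m"
    using det by (simp add: algebra_simps) (metis distrib_left mult.assoc mult.commute mult_Suc_right Suc_eq_plus1 add.commute)
  have "(n1 + n2) * q * n2 = (q * n2) * (n1 + n2)" by simp
  also have "\<dots> \<le> (m * a2) * (n1 + n2)" using q by (intro mult_right_mono) auto
  also have "\<dots> \<le> (m * (a1 + a2)) * n2" using eq by simp
  finally show "(n1 + n2) * (m * a2 div n2) \<le> m * (a1 + a2)"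
    using pos by (auto simp only: mult_le_cancel2 q_def)
  have "(m * (a1 + a2)) * n2 < (m * a2 + 1) * (n1 + n2)"
    using eq assms pos by (simp add: algebra_simps)
  also have "\<dots> \<le> ((q + 1) * n2) * (n1 + n2)" using q by (intro mult_right_mono) auto
  also have "\<dots> = ((n1 + n2) * Suc q) * n2" by (simp add: algebra_simps)
  finally show "m * (a1 + a2) < (n1 + n2) * Suc (m * a2 div n2)"
    using pos by (auto simp only: mult_less_cancel2 q_def)
qed

text \<open>Beyond n2 the line of the sum lies above a2 + k a1/n1 by (n1 - k)/(n1 (n1 + n2)), which
  is nonnegative and less than 1/n1, so again no integer is passed.\<close>

lemma floor_right:
  assumes "k \<le> n1"
  shows "(n2 + k) * (a1 + a2) div (n1 + n2) = a2 + k * a1 div n1"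
proof -
  define q where "q = k * a1 div n1"
  have q: "q * n1 \<le> k * a1" "k * a1 + 1 \<le> (q + 1) * n1"
    using pos dividend_less_div_times[of n1 "k * a1"]
    by (auto simp: q_def) 
  have e1: "n2 * (a1 + a2) = a2 * (n1 + n2) + 1" using det by (simp add: algebra_simps)
  have e2: "(a1 + a2) * n1 + 1 = a1 * (n1 + n2)" using det by (simp add: algebra_simps)
  have eq: "(1 + k * (a1 + a2)) * n1 + k = (k * a1) * (n1 + n2) + n1"
  proof -
    have "(1 + k * (a1 + a2)) * n1 + k = n1 + k * ((a1 + a2) * n1 + 1)" by (simp add: algebra_simps)
    then show ?thesis unfolding e2 by (simp add: algebra_simps)
  qed
  have "(1 + k * (a1 + a2)) div (n1 + n2) = q"
  proof (rule div_nat_eqI)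
    have "(n1 + n2) * q * n1 = (q * n1) * (n1 + n2)" by simp
    also have "\<dots> \<le> (k * a1) * (n1 + n2)" using q by (intro mult_right_mono) auto
    also have "\<dots> \<le> (1 + k * (a1 + a2)) * n1" using eq assms by linarith
    finally show "(n1 + n2) * q \<le> 1 + k * (a1 + a2)" using pos by (auto simp only: mult_le_cancel2)
    have "(1 + k * (a1 + a2)) * n1 < (k * a1 + 1) * (n1 + n2)"
      using eq pos by (simp add: algebra_simps)
    also have "\<dots> \<le> ((q + 1) * n1) * (n1 + n2)" using q by (intro mult_right_mono) auto
    also have "\<dots> = ((n1 + n2) * Suc q) * n1" by (simp add: algebra_simps)
    finally show "1 + k * (a1 + a2) < (n1 + n2) * Suc q" using pos by (auto simp only: mult_less_cancel2)
  qed
  moreover have "(n2 + k) * (a1 + a2) = a2 * (n1 + n2) + (1 + k * (a1 + a2))"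
    using e1 by (simp add: algebra_simps)
  ultimately show ?thesis using pos by (simp only: q_def div_mult_self3)
qed

lemma christoffel_left: "m < n2 \<Longrightarrow> christoffel (a1 + a2) (n1 + n2) m = christoffel a2 n2 m"
  using floor_left[of m] floor_left[of "Suc m"] by (simp add: christoffel_def)

lemma christoffel_right:
  "m < n1 \<Longrightarrow> christoffel (a1 + a2) (n1 + n2) (n2 + m) = christoffel a1 n1 m"
  using floor_right[of m] floor_right[of "Suc m"] by (simp add: christoffel_def)

text \<open>This is the standard factorization of a Christoffel word, with the factor of smaller
  slope first.\<close>

lemma word_matrix_christoffel_add:
  "word_matrix (christoffel (a1 + a2) (n1 + n2)) (n1 + n2) =
     word_matrix (christoffel a2 n2) n2 ** word_matrix (christoffel a1 n1) n1"
proof -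
  define h where "h = christoffel (a1 + a2) (n1 + n2)"
  have "word_matrix h (n1 + n2) = word_matrix h n2 ** word_matrix (\<lambda>m. h (n2 + m)) n1"
    using word_matrix_add[of h n2 n1] by (simp add: add.commute)
  moreover have "word_matrix h n2 = word_matrix (christoffel a2 n2) n2"
    "word_matrix (\<lambda>m. h (n2 + m)) n1 = word_matrix (christoffel a1 n1) n1"
    using christoffel_left christoffel_right by (auto simp: h_def intro!: word_matrix_cong)
  ultimately show ?thesis by (simp add: h_def)
qed

end

lemma cohn_matrix_add:
  assumes "a1 * b2 = a2 * b1 + 1"
  shows "cohn_matrix (a1 + a2) (b1 + b2) = cohn_matrix a2 b2 ** cohn_matrix a1 b1"
proof -
  have "a1 > 0" "b2 > 0" using assms by (auto intro: gr0I)
  \<comment> \<open>The shear from (a, b) to (a, a + b) preserves the determinant, so the floor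
    lemmas apply with lengths a + b.\<close>
  then show ?thesis
    using word_matrix_christoffel_add[of a1 "a2 + b2" a2 "a1 + b1"] assms
    by (simp add: cohn_matrix_def algebra_simps)
qed

lemma cohn_matrix_1_0: "cohn_matrix 1 0 = cohn_A"
  by (simp add: cohn_matrix_def christoffel_def)

lemma cohn_matrix_0_1: "cohn_matrix 0 1 = cohn_B"
  by (simp add: cohn_matrix_def christoffel_def)

section \<open>The Stern-Brocot tree and the Markoff equation\<close>

definition cohn :: "nat \<Rightarrow> nat \<Rightarrow> int" where "cohn a b = cohn_matrix a b $ 1 $ 2"

text \<open>In a nonnegative pair of determinant 1 other than the standard basis, one vector
  dominates the other in both coordinates and can be reduced by subtraction. Read backwards, this
  generates all such pairs by passing to sums.\<close>

lemma unimodular_pair_induct [consumes 1, case_names base left right]: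
  fixes a b c d :: nat
  assumes "a * d = c * b + 1"
    and "P 1 0 0 1"
    and "\<And>a b c d. a * d = c * b + 1 \<Longrightarrow> P a b c d \<Longrightarrow> P (a + c) (b + d) c d"
    and "\<And>a b c d. a * d = c * b + 1 \<Longrightarrow> P a b c d \<Longrightarrow> P a b (a + c) (b + d)"
  shows "P a b c d"
  using assms(1)
proof (induction "a + b + c + d" arbitrary: a b c d rule: less_induct)
  case less
  have pos: "a > 0" "d > 0" using less.prems by (auto intro: gr0I)
  consider "c \<le> a" "d \<le> b" | "a \<le> c" "b \<le> d" | "c < a" "b < d" | "a < c" "d < b"
    by linarith
  then show ?case
  proof cases
    case 1
    then obtain a' b' where ab: "a = a' + c" "b = b' + d"
      by (metis add.commute le_Suc_ex)
    then have "a' * d = c * b' + 1"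
      using less.prems by (simp add: algebra_simps)
    moreover from this have "P a' b' c d"
      using ab pos by (intro less.hyps) auto
    ultimately show ?thesis using assms(3) ab by blast
  next
    case 2
    then obtain c' d' where cd: "c = a + c'" "d = b + d'"
      by (metis le_Suc_ex)
    then have "a * d' = c' * b + 1"
      using less.prems by (simp add: algebra_simps)
    moreover from this have "P a b c' d'"
      using cd pos by (intro less.hyps) auto
    ultimately show ?thesis using assms(4) cd by blast
  next
    \<comment> \<open>Here (c + 1)(b + 1) is at most a d = c b + 1, which forces b = c = 0 and hence
      the standard basis.\<close>
    case 3
    have "(c + 1) * (b + 1) \<le> a * d" using 3 by (intro mult_mono) auto
    then have "c = 0" "b = 0" using less.prems by auto
    then show ?thesis using less.prems assms(2) by simp
  next
    case 4
    have "a * d \<le> c * b" using 4 by (intro mult_mono) auto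
    then show ?thesis using less.prems by simp
  qed
qed

text \<open>Cayley-Hamilton for determinant 1 reads X^2 = trace(X) X - 1. Multiplying by Y on one
  side and applying a linear functional, trace or entry, gives all four identities.\<close>

lemma cohn_mult:
  fixes X Y :: "int^2^2"
  assumes "det X = 1"
  shows "trace (Y ** X ** X) = trace X * trace (Y ** X) - trace Y"
    and "(Y ** X ** X) $ 1 $ 2 = trace X * (Y ** X) $ 1 $ 2 - Y $ 1 $ 2"
    and "(X ** X ** Y) $ 1 $ 2 = trace X * (X ** Y) $ 1 $ 2 - Y $ 1 $ 2"
    and "trace (X ** X ** Y) = trace X * trace (X ** Y) - trace Y"
  using assms
  by (simp_all add: det_2 trace_def sum_2 matrix_matrix_mult_def) algebra+

text \<open>Trace and upper right entry satisfy the same recursion, by Cayley--Hamilton; hence the relation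
  trace = 3 * (upper right entry) propagates along the Stern--Brocot tree.\<close>

lemma cohn_trace:
  assumes "a * d = c * b + 1"
  shows "trace (cohn_matrix a b) = 3 * cohn a b \<and> trace (cohn_matrix c d) = 3 * cohn c d \<and>
    trace (cohn_matrix (a + c) (b + d)) = 3 * cohn (a + c) (b + d)"
  using assms
proof (induction rule: unimodular_pair_induct)
  \<comment> \<open>The recursion has order two, so the sum of the pair is carried along. The three
    starting matrices \<open>cohn_A\<close>, \<open>cohn_B\<close> and
    \<open>cohn_B ** cohn_A\<close> have traces 3, 3, 6 and upper right entries 1, 1, 2.\<close>
  case base
  have "cohn_matrix 1 1 = cohn_B ** cohn_A"
    using cohn_matrix_add[of 1 1 0 0] by (simp add: cohn_matrix_0_1 cohn_matrix_1_0 flip: One_nat_def)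
  then show ?case
    unfolding cohn_def
    by (simp add: cohn_matrix_0_1 cohn_matrix_1_0 cohn_A_def cohn_B_def trace_def sum_2
        matrix_matrix_mult_def flip: One_nat_def)
next
  case (left a b c d)
  define X Y where "X = cohn_matrix a b" and "Y = cohn_matrix c d"
  have m: "cohn_matrix (a + c) (b + d) = Y ** X" "cohn_matrix (a + c + c) (b + d + d) = Y ** Y ** X"
    using left.hyps cohn_matrix_add[of a d c b] cohn_matrix_add[of "a + c" d c "b + d"]
    by (auto simp: X_def Y_def algebra_simps matrix_mul_assoc)
  have "det Y = 1" by (simp add: Y_def cohn_matrix_def det_word_matrix)
  then show ?case
    using left.IH cohn_mult(3,4)[of Y X] unfolding cohn_def m
    by (auto simp: algebra_simps simp flip: X_def Y_def)
next
  case (right a b c d)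
  define X Y where "X = cohn_matrix a b" and "Y = cohn_matrix c d"
  have m: "cohn_matrix (a + c) (b + d) = Y ** X" "cohn_matrix (a + (a + c)) (b + (b + d)) = Y ** X ** X"
    using right.hyps cohn_matrix_add[of a d c b] cohn_matrix_add[of "a" "b + d" "a + c" "b"]
    by (auto simp: X_def Y_def algebra_simps matrix_mul_assoc)
  have "det X = 1" by (simp add: X_def cohn_matrix_def det_word_matrix)
  then show ?case
    using right.IH cohn_mult(1,2)[of X Y] unfolding cohn_def m
    by (auto simp: algebra_simps simp flip: X_def Y_def)
qed

text \<open>The Markoff equation is quadratic in each variable, and the two roots for given x, y add
  up to 3 x y. Each formula keeps one vector of the pair and the sum, and exchanges the value at the
  other vector for the second root.\<close>

lemma cohn_vieta:
  assumes "a * d = c * b + 1"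
  shows "cohn (a + (a + c)) (b + (b + d)) = 3 * cohn a b * cohn (a + c) (b + d) - cohn c d"
    and "cohn (a + c + c) (b + d + d) = 3 * cohn c d * cohn (a + c) (b + d) - cohn a b"
proof -
  define X Y where "X = cohn_matrix a b" and "Y = cohn_matrix c d"
  have m: "cohn_matrix (a + c) (b + d) = Y ** X" "cohn_matrix (a + (a + c)) (b + (b + d)) = Y ** X ** X"
    "cohn_matrix (a + c + c) (b + d + d) = Y ** Y ** X"
    using assms cohn_matrix_add[of a d c b] cohn_matrix_add[of "a" "b + d" "a + c" "b"]
      cohn_matrix_add[of "a + c" d c "b + d"]
    by (auto simp: X_def Y_def algebra_simps matrix_mul_assoc)
  have "det X = 1" "det Y = 1" by (simp_all add: X_def Y_def cohn_matrix_def det_word_matrix)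
  then show "cohn (a + (a + c)) (b + (b + d)) = 3 * cohn a b * cohn (a + c) (b + d) - cohn c d"
    "cohn (a + c + c) (b + d + d) = 3 * cohn c d * cohn (a + c) (b + d) - cohn a b"
    using cohn_trace[OF assms] cohn_mult(2)[of X Y] cohn_mult(3)[of Y X] unfolding cohn_def m
    by (auto simp flip: X_def Y_def)
qed

lemma cohn_1_0: "cohn 1 0 = 1" and cohn_0_1: "cohn 0 1 = 1" and cohn_1_1: "cohn 1 1 = 2"
proof -
  show "cohn 1 0 = 1" "cohn 0 1 = 1"
    by (simp_all only: cohn_def cohn_matrix_0_1 cohn_matrix_1_0) (simp_all add: cohn_A_def cohn_B_def)
  have "cohn_matrix 1 1 = cohn_B ** cohn_A"
    using cohn_matrix_add[of 1 1 0 0] by (simp add: cohn_matrix_0_1 cohn_matrix_1_0 flip: One_nat_def)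
  then show "cohn 1 1 = 2"
    unfolding cohn_def by (simp add: cohn_A_def cohn_B_def sum_2 matrix_matrix_mult_def)
qed

text \<open>Since y <= z <= x z, the new root 3 x z - y is at least 2 x z. Keeping the maximum thus
  guarantees that the new root is positive and is the new maximum.\<close>

lemma vieta_step:
  fixes x y z :: int
  assumes "x > 0" "y > 0" "z \<ge> max x y" "x\<^sup>2 + y\<^sup>2 + z\<^sup>2 = 3 * x * y * z"
  shows "3 * x * z - y \<ge> max x z"
    "x\<^sup>2 + z\<^sup>2 + (3 * x * z - y)\<^sup>2 = 3 * x * z * (3 * x * z - y)"
proof -
  have "1 * z \<le> x * z" using assms by (intro mult_right_mono) auto
  moreover have "x * 1 \<le> x * z" using assms by (intro mult_left_mono) auto
  moreover have "3 * x * z = 3 * (x * z)" by simp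
  ultimately show "3 * x * z - y \<ge> max x z" using assms by linarith
  show "x\<^sup>2 + z\<^sup>2 + (3 * x * z - y)\<^sup>2 = 3 * x * z * (3 * x * z - y)"
    using assms(4) by algebra
qed

text \<open>Dominance of the value at the sum is part of the induction because
  \<open>vieta_step\<close> needs it to stay on the ascending branch.\<close>

lemma cohn_markoff:
  assumes "a * d = c * b + 1"
  shows "cohn a b > 0 \<and> cohn c d > 0 \<and> cohn (a + c) (b + d) \<ge> max (cohn a b) (cohn c d) \<and>
    (cohn a b)\<^sup>2 + (cohn c d)\<^sup>2 + (cohn (a + c) (b + d))\<^sup>2 =
      3 * cohn a b * cohn c d * cohn (a + c) (b + d)"
  using assms
proof (induction rule: unimodular_pair_induct)
  case base
  then show ?case by (simp add: cohn_1_0 cohn_0_1 cohn_1_1 flip: One_nat_def)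
next
  case (left a b c d)
  then show ?case
    using vieta_step[of "cohn c d" "cohn a b" "cohn (a + c) (b + d)"] cohn_vieta(2)[OF left.hyps]
    by (auto simp: mult_ac add_ac)
next
  case (right a b c d)
  then show ?case
    using vieta_step[of "cohn a b" "cohn c d" "cohn (a + c) (b + d)"] cohn_vieta(1)[OF right.hyps]
    by auto
qed

section \<open>Matchings of a strip of triangles\<close>

text \<open>Two consecutive triangles pivot about \<open>p\<close>, leading from the crossed edge
  with ends \<open>p\<close>, \<open>q\<close> to the one with ends \<open>r\<close>,
  \<open>s\<close>. They share the edge from \<open>p\<close> to \<open>r\<close>. If
  \<open>r\<close> has to be covered, either the later triangle takes \<open>r\<close> and the
  earlier one \<open>p\<close> or \<open>q\<close>, or the later one takes \<open>p\<close> and the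
  earlier one \<open>r\<close>. If \<open>s\<close> has to be covered, only the later triangle can
  take it.\<close>

lemma transversals_step:
  assumes TN: "T N = {p, q, r}" "T (Suc N) = {p, s, r}"
    and dist: "distinct [p, q, r, s]"
    and V: "p \<in> V" "q \<in> V" "r \<notin> V" "s \<notin> V"
    and new: "\<And>k. k < N \<Longrightarrow> r \<notin> T k \<and> s \<notin> T k"
  shows "transversals T (Suc (Suc N)) (insert r V) =
      2 * transversals T N (V - {p}) + transversals T N (V - {q})"
    and "transversals T (Suc (Suc N)) (insert s V) =
      transversals T N (V - {p}) + transversals T N (V - {q})"
proof -
  have V_sum: "transversals T (Suc N) V = transversals T N (V - {p}) + transversals T N (V - {q})"
  proof -
    have "T N \<inter> V = {p, q}" using TN V by auto
    then show ?thesis using dist by simp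
  qed
  \<comment> \<open>With \<open>p\<close> gone to the later triangle, only triangle \<open>N\<close>
    still reaches \<open>r\<close>; the option of its taking \<open>q\<close> contributes 0.\<close>
  have "transversals T (Suc N) (insert r V - {p}) = transversals T N (V - {p})"
  proof -
    have "T N \<inter> (insert r V - {p}) = {q, r}" using TN V dist by auto
    moreover have "transversals T N (insert r V - {p} - {q}) = 0"
      using new dist by (intro transversals_eq_0[of r]) auto
    moreover have "insert r V - {p} - {r} = V - {p}" using V by auto
    ultimately show ?thesis using dist by simp
  qed
  moreover have "T (Suc N) \<inter> insert r V = {p, r}" "insert r V - {r} = V"
    using TN V dist by auto
  ultimately show "transversals T (Suc (Suc N)) (insert r V) =
      2 * transversals T N (V - {p}) + transversals T N (V - {q})"
    using V_sum dist unfolding transversals.simps(2)[of T "Suc N"] by (simp del: transversals.simps)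
  have "transversals T (Suc N) (insert s V - {p}) = 0"
    using new dist TN by (intro transversals_eq_0[of s]) (auto simp: less_Suc_eq)
  moreover have "T (Suc N) \<inter> insert s V = {p, s}" "insert s V - {s} = V"
    using TN V dist by auto
  ultimately show "transversals T (Suc (Suc N)) (insert s V) =
      transversals T N (V - {p}) + transversals T N (V - {q})"
    using V_sum dist unfolding transversals.simps(2)[of T "Suc N"] by (simp del: transversals.simps)
qed

definition up_triangle :: "int \<Rightarrow> int \<Rightarrow> (int \<times> int) set" where
  "up_triangle x y = {(x, y), (x + 1, y), (x, y + 1)}"

definition down_triangle :: "int \<Rightarrow> int \<Rightarrow> (int \<times> int) set" where
  "down_triangle x y = {(x + 1, y), (x, y + 1), (x + 1, y + 1)}"

text \<open>A segment with positive coordinates passes through unit cells, each of which is an up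
  triangle followed by a down triangle; \<open>i m\<close> is the column of the \<open>m\<close>-th cell, counted from 1, and
  its lower left corner lies on the line \<open>x + y = m - 1\<close>.\<close>

definition strip :: "(nat \<Rightarrow> nat) \<Rightarrow> nat \<Rightarrow> (int \<times> int) set" where
  "strip i k = (let m = Suc (k div 2) in
     (if even k then up_triangle else down_triangle) (int (i m)) (int m - 1 - int (i m)))"

text \<open>The lower and upper corners are the ends of the antidiagonal edge common to both
  triangles of the m-th cell, on the line x + y = m.\<close>

abbreviation lower_corner :: "(nat \<Rightarrow> nat) \<Rightarrow> nat \<Rightarrow> int \<times> int" where
  "lower_corner i m \<equiv> (int (i m) + 1, int m - 1 - int (i m))"

abbreviation upper_corner :: "(nat \<Rightarrow> nat) \<Rightarrow> nat \<Rightarrow> int \<times> int" where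
  "upper_corner i m \<equiv> (int (i m), int m - int (i m))"

text \<open>Two points per level: these are the black vertices that remain once both tips of the
  chain, O and X, are deleted.\<close>

definition strip_vertices :: "(nat \<Rightarrow> nat) \<Rightarrow> nat \<Rightarrow> (int \<times> int) set" where
  "strip_vertices i m = lower_corner i ` {1..m} \<union> upper_corner i ` {1..m}"

text \<open>The level x + y serves as a clock: points of a higher level cannot occur in earlier
  triangles.\<close>

lemma strip_level: "p \<in> strip i k \<Longrightarrow> fst p + snd p \<le> int (Suc ((k + 1) div 2))"
  by (cases "even k")
    (auto simp: strip_def up_triangle_def down_triangle_def Let_def elim!: evenE oddE)

lemma strip_vertices_level: "p \<in> strip_vertices i m \<Longrightarrow> fst p + snd p \<le> int m"
  by (auto simp: strip_vertices_def)

lemma strip_vertices_Suc: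
  "strip_vertices i (Suc m) =
    insert (lower_corner i (Suc m)) (insert (upper_corner i (Suc m)) (strip_vertices i m))"
  by (auto simp: strip_vertices_def atLeastAtMostSuc_conv)

lemma strip_even: "strip i (2 * m) = up_triangle (int (i (Suc m))) (int m - int (i (Suc m)))"
  and strip_odd: "strip i (Suc (2 * m)) = down_triangle (int (i (Suc m))) (int m - int (i (Suc m)))"
  by (simp_all add: strip_def Let_def)

context
  fixes i :: "nat \<Rightarrow> nat"
  assumes i_init: "i 0 = 0" "i 1 = 0"
    and i_step: "\<And>m. i (Suc m) = i m \<or> i (Suc m) = Suc (i m)"
begin

text \<open>The two first-row entries count the ways in which the triangles below the crossed edge number
  \<open>Suc m\<close> can be matched so that the lower, respectively the upper, end point of this edge is
  left over.\<close>

lemma strip_transversals_aux: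
  defines "h \<equiv> \<lambda>m. i m \<noteq> i (Suc m)"
  shows "int (transversals (strip i) (Suc (2 * m)) (strip_vertices i (Suc m) - {lower_corner i (Suc m)})) =
      word_matrix h (Suc m) $ 1 $ 1 \<and>
    int (transversals (strip i) (Suc (2 * m)) (strip_vertices i (Suc m) - {upper_corner i (Suc m)})) =
      word_matrix h (Suc m) $ 1 $ 2"
proof (induction m)
  \<comment> \<open>The initial columns agree, so the word starts with \<open>cohn_B\<close>, whose
    first row (1, 1) counts the single choice for the first triangle in either case.\<close>
  case 0
  have "strip_vertices i 1 = {(1, 0), (0, 1)}" "strip i 0 = {(0, 0), (1, 0), (0, 1)}" "\<not> h 0"
    using i_init by (auto simp: strip_vertices_def strip_def up_triangle_def h_def)
  then show ?case
    using i_init by (simp add: cohn_B_def matrix_matrix_mult_def sum_2 insert_Diff_if mat_def)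
next
  case (Suc m)
  define N V where "N = Suc (2 * m)" and "V = strip_vertices i (Suc m)"
  define p q where "p = lower_corner i (Suc m)" and "q = upper_corner i (Suc m)"
  define p' q' where "p' = lower_corner i (Suc (Suc m))" and "q' = upper_corner i (Suc (Suc m))"
  have lev: "fst p' + snd p' = int m + 2" "fst q' + snd q' = int m + 2"
    by (auto simp: p'_def q'_def)
  have V: "p \<in> V" "q \<in> V" by (auto simp: p_def q_def V_def strip_vertices_Suc)
  have nV: "p' \<notin> V" "q' \<notin> V" using strip_vertices_level lev by (fastforce simp: V_def)+
  \<comment> \<open>The first \<open>2 * m + 1\<close> triangles reach level \<open>m + 1\<close> at
    most, and the new end points have level \<open>m + 2\<close>.\<close>
  have new: "p' \<notin> strip i k \<and> q' \<notin> strip i k" if "k < N" for k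
  proof -
    have "int (Suc ((k + 1) div 2)) < int m + 2" using that by (auto simp: N_def)
    then show ?thesis using lev strip_level[of p' i k] strip_level[of q' i k] by auto
  qed
  have V': "strip_vertices i (Suc (Suc m)) - {p'} = insert q' V"
    "strip_vertices i (Suc (Suc m)) - {q'} = insert p' V"
    using nV by (auto simp: strip_vertices_Suc[of i "Suc m"] V_def p'_def q'_def)
  have TN: "strip i N = down_triangle (int (i (Suc m))) (int m - int (i (Suc m)))"
    "strip i (Suc N) = up_triangle (int (i (Suc (Suc m)))) (int m + 1 - int (i (Suc (Suc m))))"
    using strip_even[of i "Suc m"] by (simp_all add: N_def strip_odd add.commute)
  define x y where "x = transversals (strip i) N (V - {p})"
    and "y = transversals (strip i) N (V - {q})"
  have IH: "int x = word_matrix h (Suc m) $ 1 $ 1" "int y = word_matrix h (Suc m) $ 1 $ 2"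
    using Suc by (simp_all add: x_def y_def N_def V_def p_def q_def del: word_matrix.simps transversals.simps)
  have pq: "p \<noteq> q" "p' \<noteq> q'" by (auto simp: p_def q_def p'_def q'_def)
  have dist: "distinct [p, q, p', q']" using pq V nV by auto
  have "int (transversals (strip i) (Suc (Suc N)) (insert q' V)) = word_matrix h (Suc (Suc m)) $ 1 $ 1 \<and>
    int (transversals (strip i) (Suc (Suc N)) (insert p' V)) = word_matrix h (Suc (Suc m)) $ 1 $ 2"
  \<comment> \<open>If the column changes, the two triangles pivot about the lower end
    \<open>p\<close>, otherwise about the upper end \<open>q\<close>; the step lemma is the same
    with the roles exchanged.\<close>
  proof (cases "h (Suc m)")
    case True
    then have i': "i (Suc (Suc m)) = Suc (i (Suc m))" using i_step[of "Suc m"] by (auto simp: h_def)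
    have T: "strip i N = {p, q, q'}" "strip i (Suc N) = {p, p', q'}"
      unfolding TN by (auto simp: i' up_triangle_def down_triangle_def p_def q_def p'_def q'_def)
    have "transversals (strip i) (Suc (Suc N)) (insert q' V) = 2 * x + y"
      "transversals (strip i) (Suc (Suc N)) (insert p' V) = x + y"
      using transversals_step[of "strip i" N p q q' p' V] T dist V nV new
      by (auto simp: x_def y_def simp del: transversals.simps)
    then show ?thesis
      using True IH unfolding word_matrix.simps(2)[of h "Suc m"]
      by (simp add: cohn_A_def matrix_matrix_mult_def sum_2 del: word_matrix.simps transversals.simps)
  next
    case False
    then have i': "i (Suc (Suc m)) = i (Suc m)" by (auto simp: h_def)
    have T: "strip i N = {q, p, p'}" "strip i (Suc N) = {q, q', p'}"
      unfolding TN by (auto simp: i' up_triangle_def down_triangle_def p_def q_def p'_def q'_def)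
    have "transversals (strip i) (Suc (Suc N)) (insert p' V) = 2 * y + x"
      "transversals (strip i) (Suc (Suc N)) (insert q' V) = y + x"
      using transversals_step[of "strip i" N q p p' q' V] T dist V nV new
      by (auto simp: x_def y_def simp del: transversals.simps)
    then show ?thesis
      using False IH unfolding word_matrix.simps(2)[of h "Suc m"]
      by (simp add: cohn_B_def matrix_matrix_mult_def sum_2 del: word_matrix.simps transversals.simps)
  qed
  then show ?case
    unfolding V'[unfolded p'_def q'_def] by (simp add: N_def p'_def q'_def del: word_matrix.simps transversals.simps)
qed

text \<open>The tip of the last triangle is deleted, so this triangle takes either end of the last
  crossed edge and the two counts are added. Adding them is what the second column (1, 1) of
  \<open>cohn_A\<close> does, hence the hypothesis that the next letter is
  \<open>cohn_A\<close>.\<close>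

lemma strip_transversals:
  defines "h \<equiv> \<lambda>m. i m \<noteq> i (Suc m)"
  assumes "h m" "m > 0"
  shows "int (transversals (strip i) (2 * m) (strip_vertices i m)) = word_matrix h (Suc m) $ 1 $ 2"
proof -
  obtain l where l: "m = Suc l" using assms(3) by (cases m) auto
  define p q V where "p = lower_corner i m" and "q = upper_corner i m" and "V = strip_vertices i m"
  have "(int (i m) + 1, int l - int (i m) + 1) \<notin> V"
    using strip_vertices_level[of "(int (i m) + 1, int l - int (i m) + 1)" i m] l by (auto simp: V_def)
  moreover have "p \<in> V" "q \<in> V"
    by (auto simp: p_def q_def V_def strip_vertices_Suc l)
  ultimately have "strip i (Suc (2 * l)) \<inter> V = {p, q}"
    unfolding strip_odd by (auto simp: down_triangle_def p_def q_def l)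
  then have "transversals (strip i) (2 * m) V =
      transversals (strip i) (Suc (2 * l)) (V - {p}) + transversals (strip i) (Suc (2 * l)) (V - {q})"
    using transversals.simps(2)[of "strip i" "Suc (2 * l)" V] l
    by (simp add: p_def q_def del: transversals.simps)
  then show ?thesis
    using strip_transversals_aux[of l] assms(2)
    by (simp add: l p_def q_def V_def h_def cohn_A_def matrix_matrix_mult_def sum_2
        del: transversals.simps)
qed

text \<open>The bottom corner of a later cell is an end of the preceding crossed edge, and the top
  corner of a cell is an end of the next one. Only the first bottom and the last top corner are
  extra.\<close>

lemma Union_strip:
  assumes "m > 0"
  shows "(\<Union>k<2 * m. strip i k) =
    strip_vertices i m \<union> {(0, 0), (int (i m) + 1, int m - int (i m))}"
  using assms
proof (induction m rule: nat_induct_non_zero)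
  case 1
  then show ?case
    using i_init by (auto simp: strip_def up_triangle_def down_triangle_def strip_vertices_def
        lessThan_Suc numeral_2_eq_2)
next
  case (Suc m)
  define low where "low = (int (i (Suc m)), int m - int (i (Suc m)))"
  define p q where "p = lower_corner i (Suc m)" and "q = upper_corner i (Suc m)"
  define top where "top m = (int (i m) + 1, int m - int (i m))" for m
  have "m \<in> {1..m}" using Suc.hyps by simp
  then have "lower_corner i m \<in> strip_vertices i m" "upper_corner i m \<in> strip_vertices i m"
    unfolding strip_vertices_def by blast+
  moreover have "low = lower_corner i m \<or> low = upper_corner i m"
    using i_step[of m] by (auto simp: low_def)
  ultimately have low: "low \<in> strip_vertices i m" by metis
  have top: "top m = p \<or> top m = q"
    using i_step[of m] by (auto simp: p_def q_def top_def)
  have "(\<Union>k<2 * Suc m. strip i k) = (\<Union>k<2 * m. strip i k) \<union> strip i (2 * m) \<union> strip i (Suc (2 * m))"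
    by (auto simp: lessThan_Suc)
  also have "strip i (2 * m) = {low, p, q}"
    unfolding strip_even by (auto simp: up_triangle_def low_def p_def q_def)
  also have "strip i (Suc (2 * m)) = {p, q, top (Suc m)}"
    unfolding strip_odd by (auto simp: down_triangle_def top_def p_def q_def)
  also have "(\<Union>k<2 * m. strip i k) = strip_vertices i m \<union> {(0, 0), top m}"
    unfolding top_def by (rule Suc.IH)
  also have "strip_vertices i m \<union> {(0, 0), top m} \<union> {low, p, q} \<union> {p, q, top (Suc m)} =
      strip_vertices i (Suc m) \<union> {(0, 0), top (Suc m)}"
    unfolding strip_vertices_Suc p_def[symmetric] q_def[symmetric] using low top by blast
  also have "top (Suc m) = (int (i (Suc m)) + 1, int (Suc m) - int (i (Suc m)))"
    by (simp only: top_def)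
  finally show ?case .
qed

end

text \<open>The levels of the three vertices sum to 3 l + 2 for an up triangle and 3 l + 4 for a
  down triangle, with l = k div 2. These differ modulo 3, so the sum recovers the index.\<close>

lemma strip_inject:
  assumes "strip i k = strip i l"
  shows "k = l"
proof -
  have sum: "(\<Sum>p\<in>strip i k. fst p + snd p) = 3 * int (k div 2) + (if even k then 2 else 4)" for k
    by (simp add: strip_def up_triangle_def down_triangle_def Let_def)
  have 3: "3 * int (k div 2) + (if even k then 2 else 4) = 3 * int (l div 2) + (if even l then 2 else 4)"
    using sum[of k] sum[of l] assms by simp
  have n: "3 * s + 2 \<noteq> 3 * t + 4" for s t :: int by presburger
  have 1: "even k = even l"
    using 3 n[of "int (k div 2)" "int (l div 2)"] n[of "int (l div 2)" "int (k div 2)"]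
    by (cases "even k"; cases "even l") simp_all
  have "int (k div 2) = int (l div 2)"
    using 3 1 by (cases "even l") simp_all
  then have 2: "k div 2 = l div 2" by (simp only: of_nat_eq_iff)
  have "k mod 2 = l mod 2" using 1 by (cases "even l") (simp_all add: odd_iff_mod_2_eq_one)
  then show ?thesis using 2 by (metis div_mult_mod_eq)
qed

lemma finite_strip: "finite (strip i k)"
  by (simp add: strip_def up_triangle_def down_triangle_def Let_def)

section \<open>Which open triangles a segment meets\<close>

lemma rel_interior_triangle:
  fixes p e f :: "'a::euclidean_space"
  assumes indep: "\<And>s t. s *\<^sub>R e + t *\<^sub>R f = 0 \<Longrightarrow> s = 0 \<and> t = 0"
  shows "rel_interior (convex hull {p, p + e, p + f}) =
    {p + s *\<^sub>R e + t *\<^sub>R f |s t. 0 < s \<and> 0 < t \<and> s + t < 1}"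
proof -
  have ne: "e \<noteq> 0" "f \<noteq> 0" "e \<noteq> f"
    using indep[of 1 0] indep[of 0 1] indep[of 1 "-1"] by auto
  have "\<not> affine_dependent {p, p + e, p + f}"
  proof
    assume "affine_dependent {p, p + e, p + f}"
    then obtain U where U: "sum U {p, p + e, p + f} = 0" "\<exists>v\<in>{p, p + e, p + f}. U v \<noteq> 0"
      "(\<Sum>v\<in>{p, p + e, p + f}. U v *\<^sub>R v) = 0"
      by (auto simp only: affine_dependent_explicit_finite finite.intros)
    have s: "U p + U (p + e) + U (p + f) = 0"
      "U p *\<^sub>R p + U (p + e) *\<^sub>R (p + e) + U (p + f) *\<^sub>R (p + f) = 0"
      using U(1,3) ne by (simp_all add: add.assoc)
    have "U (p + e) *\<^sub>R e + U (p + f) *\<^sub>R f =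
        (U p *\<^sub>R p + U (p + e) *\<^sub>R (p + e) + U (p + f) *\<^sub>R (p + f)) - (U p + U (p + e) + U (p + f)) *\<^sub>R p"
      by (simp add: algebra_simps)
    then have "U (p + e) = 0 \<and> U (p + f) = 0" using s indep by simp
    then show False using s U(2) by auto
  qed
  then have "rel_interior (convex hull {p, p + e, p + f}) =
      {y. \<exists>u. (\<forall>x\<in>{p, p + e, p + f}. 0 < u x) \<and> sum u {p, p + e, p + f} = 1 \<and>
        (\<Sum>x\<in>{p, p + e, p + f}. u x *\<^sub>R x) = y}"
    by (rule rel_interior_convex_hull_explicit)
  also have "\<dots> = {p + s *\<^sub>R e + t *\<^sub>R f |s t. 0 < s \<and> 0 < t \<and> s + t < 1}" (is "?A = ?B")
  proof (intro set_eqI iffI)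
    fix y assume "y \<in> ?A"
    then obtain u where u: "0 < u p" "0 < u (p + e)" "0 < u (p + f)" "u p + u (p + e) + u (p + f) = 1"
      "y = u p *\<^sub>R p + u (p + e) *\<^sub>R (p + e) + u (p + f) *\<^sub>R (p + f)"
      using ne by (auto simp: add.assoc)
    have "y = (u p + u (p + e) + u (p + f)) *\<^sub>R p + u (p + e) *\<^sub>R e + u (p + f) *\<^sub>R f"
      unfolding u(5) by (simp add: algebra_simps)
    then have "y = p + u (p + e) *\<^sub>R e + u (p + f) *\<^sub>R f" unfolding u(4) by simp
    moreover have "u (p + e) + u (p + f) < 1" using u(1,4) by linarith
    ultimately show "y \<in> ?B" using u by blast
  next
    fix y assume "y \<in> ?B"
    then obtain s t where y: "y = p + s *\<^sub>R e + t *\<^sub>R f" and st: "0 < s" "0 < t" "s + t < 1"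
      by auto
    define u where "u x = (if x = p then 1 - s - t else if x = p + e then s else t)" for x
    have "u p = 1 - s - t" "u (p + e) = s" "u (p + f) = t" using ne by (auto simp: u_def)
    moreover have "(1 - s - t) *\<^sub>R p + (s *\<^sub>R (p + e) + t *\<^sub>R (p + f)) = y"
      by (simp add: y algebra_simps)
    ultimately show "y \<in> ?A"
      using ne st by (intro CollectI exI[of _ u]) simp
  qed
  finally show ?thesis .
qed

text \<open>The parameter is eliminated by cross-multiplication, as in x b < l a b < (y + 1)
  a.\<close>

lemma crossing_bounds:
  fixes a b :: nat and x y :: int and l :: real
  assumes "0 \<le> l" "l \<le> 1" "x < l * a" "l * a < x + 1" "y < l * b" "l * b < y + 1" "a > 0" "b > 0"
  shows "0 \<le> x \<and> 0 \<le> y \<and> x < a \<and> y < b \<and> x * b < (y + 1) * a \<and> y * a < (x + 1) * b"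
proof -
  have l: "0 \<le> l * a" "0 \<le> l * b" "l * a \<le> a" "l * b \<le> b"
    using assms by (auto intro: mult_left_le_one_le)
  have "real_of_int (x * b) < l * a * b" "l * b * a < real_of_int ((y + 1) * a)"
    "real_of_int (y * a) < l * b * a" "l * a * b < real_of_int ((x + 1) * b)"
    using assms by auto
  then have "real_of_int (x * b) < real_of_int ((y + 1) * a)" "real_of_int (y * a) < real_of_int ((x + 1) * b)"
    by (simp_all only: mult_ac)
  then have "x * b < (y + 1) * a" "y * a < (x + 1) * b" by (simp_all only: of_int_less_iff)
  moreover have "x < int a" "y < int b" "0 \<le> x" "0 \<le> y" using assms l by linarith+
  ultimately show ?thesis by simp
qed

lemma crossing_parameter:
  fixes a b :: nat and x y :: int
  assumes "0 \<le> x" "0 \<le> y" "x < a" "y < b" "x * b < (y + 1) * a" "y * a < (x + 1) * b"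
  shows "\<exists>l::real. 0 \<le> l \<and> l \<le> 1 \<and> x < l * a \<and> y < l * b \<and> l * (a + b) < x + y + 1" (is ?up)
    and "\<exists>l::real. 0 \<le> l \<and> l \<le> 1 \<and> l * a < x + 1 \<and> l * b < y + 1 \<and> x + y + 1 < l * (a + b)" (is ?down)
proof -
  have ab: "a > 0" "b > 0" using assms by auto
  have "real_of_int (x * b) < real_of_int ((y + 1) * a)" "real_of_int (y * a) < real_of_int ((x + 1) * b)"
    using assms by (simp_all only: of_int_less_iff)
  then have r: "real_of_int x * b < (y + 1) * a" "real_of_int y * a < (x + 1) * b" by simp_all
  \<comment> \<open>\<open>c\<close> is the parameter at which the segment meets the antidiagonal of
    the cell, a mediant of x/a and (y + 1)/b and also of y/b and (x + 1)/a. Slightly before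
    \<open>c\<close> the point lies in the up triangle, slightly after it in the down
    triangle.\<close>
  define c where "c = (real_of_int x + y + 1) / (real a + b)"
  have "real_of_int x / a < c" "real_of_int y / b < c"
    "c < (real_of_int x + 1) / a" "c < (real_of_int y + 1) / b"
    using r ab by (simp_all add: c_def divide_simps algebra_simps)
  then have c: "max (real_of_int x / a) (real_of_int y / b) < c"
    "c < min ((real_of_int x + 1) / a) ((real_of_int y + 1) / b)" by auto
  have "real_of_int x + 1 \<le> a" using assms by linarith
  then have x1: "(real_of_int x + 1) / a \<le> 1" "0 \<le> real_of_int x / a"
    using ab assms by (simp_all add: divide_simps)
  obtain l where "max (real_of_int x / a) (real_of_int y / b) < l" "l < c"
    using dense[OF c(1)] by auto
  moreover from this have "0 \<le> l" "l \<le> 1" using x1 c by auto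
  ultimately have "0 \<le> l" "l \<le> 1" "x < l * a" "y < l * b" "l * (real a + b) < x + y + 1"
    using ab by (auto simp: c_def pos_divide_less_eq pos_less_divide_eq)
  then show ?up by (intro exI[of _ l]) (auto simp: algebra_simps)
  obtain l where "l < min ((real_of_int x + 1) / a) ((real_of_int y + 1) / b)" "c < l"
    using dense[OF c(2)] by auto
  moreover from this have "0 \<le> l" "l \<le> 1" using x1 c by auto
  ultimately have "0 \<le> l" "l \<le> 1" "l * a < x + 1" "l * b < y + 1" "x + y + 1 < l * (real a + b)"
    using ab by (auto simp: c_def pos_divide_less_eq pos_less_divide_eq)
  then show ?down by (intro exI[of _ l]) (auto simp: algebra_simps)
qed

text \<open>With m = x + y + 1, the two cross-multiplied inequalities say exactly that m a - x (a +
  b) lies strictly between 0 and a + b. Hence x is the floor, and coprimality supplies the nonzero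
  remainder for the converse.\<close>

lemma crossed_cell_iff:
  fixes a b :: nat and x y :: int
  assumes "coprime a b" "a > 0" "b > 0"
  shows "0 \<le> x \<and> 0 \<le> y \<and> x < a \<and> y < b \<and> x * b < (y + 1) * a \<and> y * a < (x + 1) * b \<longleftrightarrow>
    (\<exists>m\<in>{1..a + b - 1}. x = int (m * a div (a + b)) \<and> y = int m - 1 - int (m * a div (a + b)))"
    (is "?L \<longleftrightarrow> ?R")
proof
  assume L: ?L
  define m where "m = nat (x + y + 1)"
  have m: "int m = x + y + 1" "m \<in> {1..a + b - 1}" using L by (auto simp: m_def)
  have "int m * a div (int (a + b)) = x"
    using L by (intro int_div_pos_eq[of _ _ _ "int m * a - x * (a + b)"]) (auto simp: m algebra_simps)
  then have "x = int (m * a div (a + b))"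
    by (simp add: zdiv_int)
  then show ?R using m by force
next
  assume ?R
  then obtain m where m: "1 \<le> m" "m < a + b" "x = int (m * a div (a + b))" "y = int m - 1 - x"
    using assms by force
  define r where "r = m * a mod (a + b)"
  have "int (m * a) = int ((a + b) * (m * a div (a + b)) + r)"
    by (simp only: r_def mult_div_mod_eq)
  then have ma: "int m * a = x * (a + b) + r" by (simp add: m algebra_simps)
  have "coprime (a + b) a"
    using assms(1) by (metis add.commute coprime_commute coprime_iff_gcd_eq_1 gcd_add1)
  then have "\<not> (a + b) dvd m * a"
    using m by (auto simp: coprime_dvd_mult_left_iff dest: dvd_imp_le)
  then have r: "0 < r" "r < a + b" using assms by (auto simp: r_def dvd_eq_mod_eq_0)
  have 1: "x * b + r = (y + 1) * a" using ma by (simp add: m(4) algebra_simps)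
  have 2: "y * a + (a + b - r) = (x + 1) * b" using ma r by (simp add: m(4) algebra_simps)
  have x: "0 \<le> x" by (simp add: m(3))
  have "0 < (y + 1) * int a" using 1 r x by (metis add_nonneg_pos mult_nonneg_nonneg of_nat_0_le_iff of_nat_0_less_iff)
  then have y: "0 \<le> y" by (simp add: zero_less_mult_iff)
  have "int m * a < int (a + b) * a" using m assms by simp
  then have "x * int (a + b) < a * int (a + b)" using ma r by (simp add: algebra_simps)
  then have xa: "x < a" by (rule mult_right_less_imp_less) simp
  have "int m * b = (y + 1) * int (a + b) - r" using ma by (simp add: m(4) algebra_simps)
  moreover have "int m * b \<le> (int a + b - 1) * b" using m assms by simp
  ultimately have "y * int (a + b) < b * int (a + b)" using r assms by (simp add: algebra_simps)
  then have yb: "y < b" by (rule mult_right_less_imp_less) simp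
  show ?L using x y xa yb 1 2 r by linarith
qed

section \<open>Triangles crossed by a lattice vector\<close>

definition lattice_point :: "real^3 \<Rightarrow> real^3 \<Rightarrow> int \<times> int \<Rightarrow> real^3" where
  "lattice_point e f c = of_int (fst c) *\<^sub>R e + of_int (snd c) *\<^sub>R f"

text \<open>A sector is spanned by two shortest vectors at an angle of 60 degrees; in the resulting
  coordinates the shortest vectors always form the same hexagon, so no symmetry argument is needed.\<close>

definition hexagon :: "(int \<times> int) set" where
  "hexagon = {(1, 0), (-1, 0), (0, 1), (0, -1), (1, -1), (-1, 1)}"

definition sector :: "real^3 \<Rightarrow> real^3 \<Rightarrow> bool" where
  "sector e f \<longleftrightarrow> tri_lattice = range (lattice_point e f) \<and>
     shortest_vectors tri_lattice = lattice_point e f ` hexagon \<and>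
     (\<forall>s t. s *\<^sub>R e + t *\<^sub>R f = 0 \<longrightarrow> s = 0 \<and> t = 0)"

lemma sector_base: "sector (vector [1, 0, -1]) (vector [0, 1, -1])"
proof -
  let ?e = "vector [1, 0, -1] :: real^3" and ?f = "vector [0, 1, -1] :: real^3"
  have pt: "lattice_point ?e ?f c = vector [of_int (fst c), of_int (snd c), - of_int (fst c) - of_int (snd c)]" for c
    by (simp add: lattice_point_def vec_eq_iff forall_3)
  have "tri_lattice = range (lattice_point ?e ?f)"
  proof (intro set_eqI iffI)
    fix p assume p: "p \<in> tri_lattice"
    then obtain a b where "p$1 = of_int a" "p$2 = of_int b"
      by (auto simp: tri_lattice_def elim!: Ints_cases) (metis Ints_cases)
    moreover have "p$3 = - p$1 - p$2" using p by (simp add: tri_lattice_def)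
    ultimately have "p = lattice_point ?e ?f (a, b)"
      unfolding pt by (simp add: vec_eq_iff forall_3)
    then show "p \<in> range (lattice_point ?e ?f)" by blast
  qed (auto simp: pt tri_lattice_def forall_3)
  moreover have "shortest_vectors tri_lattice = lattice_point ?e ?f ` hexagon"
    unfolding shortest_vectors_tri_lattice hexagon_def by (auto simp: pt)
  moreover have "s = 0 \<and> t = 0" if "s *\<^sub>R ?e + t *\<^sub>R ?f = 0" for s t
    using that by (simp add: vec_eq_iff forall_3)
  ultimately show ?thesis by (simp add: sector_def)
qed

lemma sector_transform:
  assumes "sector e f" "bij g" "g ` hexagon = hexagon"
    and "\<And>c. lattice_point e' f' c = lattice_point e f (g c)"
    and "\<And>s t. s *\<^sub>R e' + t *\<^sub>R f' = 0 \<Longrightarrow> s = 0 \<and> t = 0"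
  shows "sector e' f'"
proof -
  have "lattice_point e' f' = lattice_point e f \<circ> g" using assms(4) by auto
  then have "range (lattice_point e' f') = range (lattice_point e f)"
    "lattice_point e' f' ` hexagon = lattice_point e f ` hexagon"
    using assms(2,3) by (simp_all only: image_comp[symmetric] bij_is_surj)
  then show ?thesis
    using assms(1,5) by (simp add: sector_def)
qed

lemma sector_swap:
  assumes "sector e f"
  shows "sector f e"
proof (rule sector_transform[OF assms, of prod.swap])
  show "prod.swap ` hexagon = hexagon" by (auto simp: hexagon_def)
  show "s = 0 \<and> t = 0" if "s *\<^sub>R f + t *\<^sub>R e = 0" for s t
  proof -
    have "t *\<^sub>R e + s *\<^sub>R f = 0" using that by (simp add: add.commute)
    then show ?thesis using assms unfolding sector_def by blast
  qed
qed (auto simp: lattice_point_def add.commute)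

text \<open>A rotation by 60 degrees, which permutes the hexagon of shortest vectors
  cyclically.\<close>

lemma sector_rotate:
  assumes "sector e f"
  shows "sector f (f - e)"
proof (rule sector_transform[OF assms, of "\<lambda>(x, y). (- y, x + y)"])
  show "bij (\<lambda>(x, y). (- y, x + y) :: int \<times> int)"
    by (rule bij_betw_byWitness[where f' = "\<lambda>(x, y). (x + y, - x)"]) auto
  show "(\<lambda>(x, y). (- y, x + y)) ` hexagon = hexagon" by (auto simp: hexagon_def)
  show "s = 0 \<and> t = 0" if "s *\<^sub>R f + t *\<^sub>R (f - e) = 0" for s t
  proof -
    have "(- t) *\<^sub>R e + (s + t) *\<^sub>R f = 0" using that by (simp add: algebra_simps)
    then have "- t = 0 \<and> s + t = 0" using assms unfolding sector_def by blast
    then show ?thesis by simp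
  qed
qed (auto simp: lattice_point_def algebra_simps)

lemma sector_minus: "sector e f \<Longrightarrow> sector (- e) (- f)"
  using sector_rotate[of e f] sector_rotate[of f "f - e"] sector_rotate[of "f - e" "- e"] by simp

lemma lattice_point_add: "lattice_point e f (c + d) = lattice_point e f c + lattice_point e f d"
  and lattice_point_diff: "lattice_point e f (c - d) = lattice_point e f c - lattice_point e f d"
  and lattice_point_minus: "lattice_point e f (- c) = - lattice_point e f c"
  by (simp_all add: lattice_point_def algebra_simps)

text \<open>Seen from one vertex, the other two are neighbouring vectors of the hexagon. This leaves
  the six triangles around a lattice point, each listed in two orders.\<close>

lemma triangle_of_differences:
  assumes "card K = 3" "\<And>c d. c \<in> K \<Longrightarrow> d \<in> K \<Longrightarrow> c \<noteq> d \<Longrightarrow> c - d \<in> hexagon"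
  shows "\<exists>x y. K = up_triangle x y \<or> K = down_triangle x y"
proof -
  obtain c1 c2 c3 where K: "K = {c1, c2, c3}" "c1 \<noteq> c2" "c2 \<noteq> c3" "c1 \<noteq> c3"
    using assms(1) by (auto simp: card_3_iff)
  obtain x y where c1: "c1 = (x, y)" by (cases c1)
  define d2 d3 where "d2 = c2 - c1" and "d3 = c3 - c1"
  have d: "d2 \<in> hexagon" "d3 \<in> hexagon" "d3 - d2 \<in> hexagon"
    using assms(2)[of c2 c1] assms(2)[of c3 c1] assms(2)[of c3 c2] K by (auto simp: d2_def d3_def)
  have K': "K = {(x, y), (x, y) + d2, (x, y) + d3}" by (simp add: K c1 d2_def d3_def)
  define tri where "tri K \<longleftrightarrow> (\<exists>x y. K = up_triangle x y \<or> K = down_triangle x y)" for K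
  have "{(x, y), (x + 1, y), (x, y + 1)} = up_triangle x y"
    "{(x, y), (x - 1, y), (x - 1, y + 1)} = up_triangle (x - 1) y"
    "{(x, y), (x, y - 1), (x + 1, y - 1)} = up_triangle x (y - 1)"
    "{(x, y), (x - 1, y + 1), (x, y + 1)} = down_triangle (x - 1) y"
    "{(x, y), (x + 1, y - 1), (x + 1, y)} = down_triangle x (y - 1)"
    "{(x, y), (x, y - 1), (x - 1, y)} = down_triangle (x - 1) (y - 1)"
    unfolding up_triangle_def down_triangle_def by auto
  moreover have "tri (up_triangle x y)" "tri (down_triangle x y)" for x y
    by (auto simp: tri_def)
  ultimately have tri: "tri {(x, y), (x + 1, y), (x, y + 1)}" "tri {(x, y), (x - 1, y), (x - 1, y + 1)}"
    "tri {(x, y), (x, y - 1), (x + 1, y - 1)}" "tri {(x, y), (x - 1, y + 1), (x, y + 1)}"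
    "tri {(x, y), (x + 1, y - 1), (x + 1, y)}" "tri {(x, y), (x, y - 1), (x - 1, y)}"
    by (simp_all only:)
  have swap: "{c, p, q} = {c, q, p}" for c p q :: "int \<times> int" by auto
  note tri' = tri[THEN subst[OF swap, of tri]]
  have "(0 :: int \<times> int) \<notin> hexagon" by (simp add: hexagon_def prod_eq_iff)
  then have "(d2, d3) \<in> {((1, 0), (0, 1)), ((0, 1), (1, 0)), ((-1, 0), (-1, 1)), ((-1, 1), (-1, 0)),
        ((0, -1), (1, -1)), ((1, -1), (0, -1)), ((0, 1), (-1, 1)), ((-1, 1), (0, 1)),
        ((1, 0), (1, -1)), ((1, -1), (1, 0)), ((-1, 0), (0, -1)), ((0, -1), (-1, 0))}"
    using d(3) d(1,2)[unfolded hexagon_def]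
    by (elim insertE emptyE) (simp_all; simp add: hexagon_def)+
  then have "tri K"
    unfolding K' by (elim insertE emptyE) (simp_all add: tri tri')
  then show ?thesis by (simp only: tri_def)
qed

section \<open>Crossed triangles in sector coordinates\<close>

context
  fixes e f :: "real^3"
  assumes sector: "sector e f"
begin

abbreviation "pt \<equiv> lattice_point e f"

lemma coords_eq_iff: "s *\<^sub>R e + t *\<^sub>R f = s' *\<^sub>R e + t' *\<^sub>R f \<longleftrightarrow> s = s' \<and> t = t'"
proof
  assume "s *\<^sub>R e + t *\<^sub>R f = s' *\<^sub>R e + t' *\<^sub>R f"
  then have "(s - s') *\<^sub>R e + (t - t') *\<^sub>R f = 0" by (simp add: algebra_simps)
  then have "s - s' = 0 \<and> t - t' = 0" using sector unfolding sector_def by blast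
  then show "s = s' \<and> t = t'" by simp
qed auto

lemma inj_pt: "inj pt"
  by (simp add: inj_def lattice_point_def coords_eq_iff prod_eq_iff)

lemma pt_eq_iff: "pt c = pt d \<longleftrightarrow> c = d"
  using inj_pt by (rule inj_eq)

lemma dissection_triangle_iff:
  "dissection_triangle T \<longleftrightarrow> (\<exists>x y. T = pt ` up_triangle x y \<or> T = pt ` down_triangle x y)"
proof
  assume T: "dissection_triangle T"
  then have "T \<subseteq> range pt" using sector by (auto simp: dissection_triangle_def sector_def)
  then obtain K where K: "T = pt ` K" by (metis subset_image_iff)
  have "\<exists>x y. K = up_triangle x y \<or> K = down_triangle x y"
  proof (rule triangle_of_differences)
    show "card K = 3"
      using T card_image[OF inj_on_subset[OF inj_pt], of K] by (simp add: K dissection_triangle_def)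
    fix c d assume "c \<in> K" "d \<in> K" "c \<noteq> d"
    then have "pt (c - d) \<in> pt ` hexagon"
      using T sector by (auto simp: K dissection_triangle_def sector_def lattice_point_diff pt_eq_iff)
    then show "c - d \<in> hexagon" by (auto simp: pt_eq_iff)
  qed
  then show "\<exists>x y. T = pt ` up_triangle x y \<or> T = pt ` down_triangle x y" using K by blast
next
  have image: "dissection_triangle (pt ` K)"
    if K: "card K = 3" "\<forall>c\<in>K. \<forall>d\<in>K. c \<noteq> d \<longrightarrow> c - d \<in> hexagon" for K
    unfolding dissection_triangle_def
  proof (intro conjI ballI impI)
    show "pt ` K \<subseteq> tri_lattice" using sector by (auto simp: sector_def)
    show "card (pt ` K) = 3" using card_image[OF inj_on_subset[OF inj_pt], of K] K by simp
    fix p q assume "p \<in> pt ` K" "q \<in> pt ` K" "p \<noteq> q"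
    then obtain c d where cd: "c \<in> K" "d \<in> K" "c \<noteq> d" "p = pt c" "q = pt d" by (elim imageE) metis
    then have "c - d \<in> hexagon" using K(2) by simp
    then show "p - q \<in> shortest_vectors tri_lattice"
      using sector unfolding cd lattice_point_diff[symmetric] sector_def by (simp only: imageI)
  qed
  have "dissection_triangle (pt ` up_triangle x y)" "dissection_triangle (pt ` down_triangle x y)" for x y
    by (rule image; auto simp: up_triangle_def down_triangle_def hexagon_def)+
  then show "dissection_triangle T" if "\<exists>x y. T = pt ` up_triangle x y \<or> T = pt ` down_triangle x y"
    using that by auto
qed

lemma closed_segment_pt:
  "closed_segment 0 (pt (int a, int b)) = {(l * a) *\<^sub>R e + (l * b) *\<^sub>R f |l::real. 0 \<le> l \<and> l \<le> 1}"
  by (simp add: closed_segment_def lattice_point_def scaleR_right_distrib)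

lemma meets_up_triangle:
  fixes a b :: nat and x y :: int
  shows "closed_segment 0 (pt (int a, int b)) \<inter> rel_interior (convex hull (pt ` up_triangle x y)) \<noteq> {} \<longleftrightarrow>
    (\<exists>l::real. 0 \<le> l \<and> l \<le> 1 \<and> x < l * a \<and> y < l * b \<and> l * (a + b) < x + y + 1)"
proof -
  have "pt ` up_triangle x y = {pt (x, y), pt (x, y) + e, pt (x, y) + f}"
    by (simp add: up_triangle_def lattice_point_def algebra_simps)
  then have "rel_interior (convex hull (pt ` up_triangle x y)) =
      {pt (x, y) + s *\<^sub>R e + t *\<^sub>R f |s t. 0 < s \<and> 0 < t \<and> s + t < 1}"
    using sector by (simp add: rel_interior_triangle sector_def)
  also have "\<dots> = {(x + s) *\<^sub>R e + (y + t) *\<^sub>R f |(s::real) (t::real). 0 < s \<and> 0 < t \<and> s + t < 1}"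
    by (simp add: lattice_point_def algebra_simps)
  finally have "closed_segment 0 (pt (int a, int b)) \<inter> rel_interior (convex hull (pt ` up_triangle x y)) \<noteq> {} \<longleftrightarrow>
      (\<exists>(l::real) (s::real) (t::real). 0 \<le> l \<and> l \<le> 1 \<and> 0 < s \<and> 0 < t \<and> s + t < 1 \<and>
        (l * a) *\<^sub>R e + (l * b) *\<^sub>R f = (x + s) *\<^sub>R e + (y + t) *\<^sub>R f)"
    unfolding closed_segment_pt by blast
  also have "\<dots> \<longleftrightarrow> (\<exists>(l::real) (s::real) (t::real). 0 \<le> l \<and> l \<le> 1 \<and> 0 < s \<and> 0 < t \<and> s + t < 1 \<and>
      l * a = x + s \<and> l * b = y + t)"
    by (simp only: coords_eq_iff)
  also have "\<dots> \<longleftrightarrow> (\<exists>l::real. 0 \<le> l \<and> l \<le> 1 \<and> x < l * a \<and> y < l * b \<and> l * (a + b) < x + y + 1)"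
  proof (intro iffI; elim exE conjE)
    fix l :: real assume "0 \<le> l" "l \<le> 1" "x < l * a" "y < l * b" "l * (a + b) < x + y + 1"
    then show "\<exists>(l::real) (s::real) (t::real). 0 \<le> l \<and> l \<le> 1 \<and> 0 < s \<and> 0 < t \<and> s + t < 1 \<and> l * a = x + s \<and> l * b = y + t"
      by (intro exI[of _ l] exI[of _ "l * a - x"] exI[of _ "l * b - y"]) (auto simp: algebra_simps)
  qed (auto simp: algebra_simps)
  finally show ?thesis .
qed

lemma meets_down_triangle:
  fixes a b :: nat and x y :: int
  shows "closed_segment 0 (pt (int a, int b)) \<inter> rel_interior (convex hull (pt ` down_triangle x y)) \<noteq> {} \<longleftrightarrow>
    (\<exists>l::real. 0 \<le> l \<and> l \<le> 1 \<and> l * a < x + 1 \<and> l * b < y + 1 \<and> x + y + 1 < l * (a + b))"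
proof -
  \<comment> \<open>Seen from its top corner, a down triangle is an up triangle for the opposite
    sector.\<close>
  have "pt ` down_triangle x y = {pt (x + 1, y + 1), pt (x + 1, y + 1) + - e, pt (x + 1, y + 1) + - f}"
    by (auto simp add: down_triangle_def lattice_point_def algebra_simps)
  then have "rel_interior (convex hull (pt ` down_triangle x y)) =
      {pt (x + 1, y + 1) + s *\<^sub>R (- e) + t *\<^sub>R (- f) |s t. 0 < s \<and> 0 < t \<and> s + t < 1}"
    using sector_minus[OF sector] by (simp only: rel_interior_triangle sector_def)
  also have "\<dots> = {(x + 1 - s) *\<^sub>R e + (y + 1 - t) *\<^sub>R f |(s::real) (t::real). 0 < s \<and> 0 < t \<and> s + t < 1}"
    by (simp add: lattice_point_def algebra_simps)
  finally have "closed_segment 0 (pt (int a, int b)) \<inter> rel_interior (convex hull (pt ` down_triangle x y)) \<noteq> {} \<longleftrightarrow>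
      (\<exists>(l::real) (s::real) (t::real). 0 \<le> l \<and> l \<le> 1 \<and> 0 < s \<and> 0 < t \<and> s + t < 1 \<and>
        (l * a) *\<^sub>R e + (l * b) *\<^sub>R f = (x + 1 - s) *\<^sub>R e + (y + 1 - t) *\<^sub>R f)"
    unfolding closed_segment_pt by blast
  also have "\<dots> \<longleftrightarrow> (\<exists>(l::real) (s::real) (t::real). 0 \<le> l \<and> l \<le> 1 \<and> 0 < s \<and> 0 < t \<and> s + t < 1 \<and>
      l * a = x + 1 - s \<and> l * b = y + 1 - t)"
    by (simp only: coords_eq_iff)
  also have "\<dots> \<longleftrightarrow> (\<exists>l::real. 0 \<le> l \<and> l \<le> 1 \<and> l * a < x + 1 \<and> l * b < y + 1 \<and> x + y + 1 < l * (a + b))"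
  proof (intro iffI; elim exE conjE)
    fix l :: real assume "0 \<le> l" "l \<le> 1" "l * a < x + 1" "l * b < y + 1" "x + y + 1 < l * (a + b)"
    then show "\<exists>(l::real) (s::real) (t::real). 0 \<le> l \<and> l \<le> 1 \<and> 0 < s \<and> 0 < t \<and> s + t < 1 \<and> l * a = x + 1 - s \<and> l * b = y + 1 - t"
      by (intro exI[of _ l] exI[of _ "x + 1 - l * a"] exI[of _ "y + 1 - l * b"]) (auto simp: algebra_simps)
  qed (auto simp: algebra_simps)
  finally show ?thesis .
qed

context
  fixes a b :: nat
  assumes ab: "coprime a b" "a > 0" "b > 0"
begin

abbreviation "col m \<equiv> m * a div (a + b)"

text \<open>Both triangles of a cell lead to the same condition \<open>C\<close>, so a cell
  contributes either both of its triangles or none.\<close>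

lemma meets_cell:
  assumes "K = up_triangle x y \<or> K = down_triangle x y"
  shows "closed_segment 0 (pt (int a, int b)) \<inter> rel_interior (convex hull (pt ` K)) \<noteq> {} \<longleftrightarrow>
    (\<exists>m\<in>{1..a + b - 1}. x = int (col m) \<and> y = int m - 1 - int (col m))"
proof -
  define C where "C \<longleftrightarrow> 0 \<le> x \<and> 0 \<le> y \<and> x < a \<and> y < b \<and> x * b < (y + 1) * a \<and> y * a < (x + 1) * b"
  have C: "C" if "0 \<le> l" "l \<le> 1" "x < l * a" "l * a < x + 1" "y < l * b" "l * b < y + 1" for l :: real
    using crossing_bounds[OF that ab(2,3)] by (simp add: C_def)
  have "(\<exists>l::real. 0 \<le> l \<and> l \<le> 1 \<and> x < l * a \<and> y < l * b \<and> l * (a + b) < x + y + 1) \<longleftrightarrow> C"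
  proof
    assume C
    then show "\<exists>l::real. 0 \<le> l \<and> l \<le> 1 \<and> x < l * a \<and> y < l * b \<and> l * (a + b) < x + y + 1"
      unfolding C_def by (elim conjE) (rule crossing_parameter(1))
  qed (auto simp: algebra_simps intro: C)
  moreover have "(\<exists>l::real. 0 \<le> l \<and> l \<le> 1 \<and> l * a < x + 1 \<and> l * b < y + 1 \<and> x + y + 1 < l * (a + b)) \<longleftrightarrow> C"
  proof
    assume C
    then show "\<exists>l::real. 0 \<le> l \<and> l \<le> 1 \<and> l * a < x + 1 \<and> l * b < y + 1 \<and> x + y + 1 < l * (a + b)"
      unfolding C_def by (elim conjE) (rule crossing_parameter(2))
  qed (auto simp: algebra_simps intro: C)
  ultimately show ?thesis
    using assms unfolding C_def crossed_cell_iff[OF ab]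
    by (elim disjE) (simp_all only: meets_up_triangle meets_down_triangle)
qed

lemma crossed_triangles_eq:
  "crossed_triangles (pt (int a, int b)) = (\<lambda>k. pt ` strip col k) ` {..<2 * (a + b - 1)}"
proof (intro set_eqI iffI)
  fix T assume "T \<in> crossed_triangles (pt (int a, int b))"
  then obtain K x y where T: "T = pt ` K" "K = up_triangle x y \<or> K = down_triangle x y"
    "closed_segment 0 (pt (int a, int b)) \<inter> rel_interior (convex hull (pt ` K)) \<noteq> {}"
    by (auto simp: crossed_triangles_def dissection_triangle_iff)
  then obtain m where m: "m \<in> {1..a + b - 1}" "x = int (col m)" "y = int m - 1 - int (col m)"
    using meets_cell by blast
  obtain l where l: "m = Suc l" using m by (cases m) auto
  have "K = strip col (2 * l) \<or> K = strip col (Suc (2 * l))"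
    using T(2) m unfolding strip_even strip_odd by (simp add: l)
  moreover have "2 * l < 2 * (a + b - 1)" "Suc (2 * l) < 2 * (a + b - 1)" using m l by auto
  ultimately show "T \<in> (\<lambda>k. pt ` strip col k) ` {..<2 * (a + b - 1)}" using T(1) by blast
next
  fix T assume "T \<in> (\<lambda>k. pt ` strip col k) ` {..<2 * (a + b - 1)}"
  then obtain k where k: "k < 2 * (a + b - 1)" "T = pt ` strip col k" by auto
  define m where "m = Suc (k div 2)"
  have m: "m \<in> {1..a + b - 1}" using k by (auto simp: m_def)
  have K: "strip col k = up_triangle (col m) (int m - 1 - int (col m)) \<or>
      strip col k = down_triangle (col m) (int m - 1 - int (col m))"
    by (auto simp: strip_def m_def Let_def)
  then have "dissection_triangle T" unfolding dissection_triangle_iff k(2) by blast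
  moreover have "closed_segment 0 (pt (int a, int b)) \<inter> rel_interior (convex hull T) \<noteq> {}"
    unfolding k(2) meets_cell[OF K] using m by blast
  ultimately show "T \<in> crossed_triangles (pt (int a, int b))"
    by (simp add: crossed_triangles_def)
qed

lemma matching_number_pt_pos: "int (matching_number (pt (int a, int b))) = cohn a b"
proof -
  define u n V where "u = pt (int a, int b)" and "n = a + b" and "V = strip_vertices col (n - 1)"
  define N T where "N = 2 * (n - 1)" and "T = (\<lambda>k. pt ` strip col k)"
  have n: "n \<ge> 2" using ab by (simp add: n_def)
  have crossed: "crossed_triangles u = T ` {..<N}"
    using crossed_triangles_eq by (simp add: u_def T_def N_def n_def)
  have col: "col 0 = 0" "col 1 = 0" using ab by auto
  have step: "col (Suc m) = col m \<or> col (Suc m) = Suc (col m)" for m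
  proof -
    have "col m \<le> col (Suc m)" by (intro div_le_mono) simp
    moreover have "col (Suc m) \<le> (m * a + (a + b)) div (a + b)" by (intro div_le_mono) simp
    moreover have "(m * a + (a + b)) div (a + b) = Suc (col m)"
      using ab by (subst div_add_self2) auto
    ultimately show ?thesis by linarith
  qed
  \<comment> \<open>Together with \<open>col n = a\<close> this makes the last letter
    \<open>cohn_A\<close> and puts the top corner of the last cell at (a, b).\<close>
  have last: "col (n - 1) = a - 1"
  proof (rule div_nat_eqI)
    obtain a' where "a = Suc a'" using ab by (cases a) auto
    then show "(a + b) * (a - 1) \<le> (n - 1) * a" "(n - 1) * a < (a + b) * Suc (a - 1)"
      using ab by (simp_all add: n_def)
  qed
  have all: "col n = a" using ab by (simp add: n_def)
  \<comment> \<open>O has level 0 and X has level \<open>n\<close>, so neither belongs to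
    \<open>V\<close>.\<close>
  have level: "1 \<le> x + y \<and> x + y \<le> int n - 1" if "(x, y) \<in> V" for x y
    using that n by (auto simp: V_def strip_vertices_def)
  have "\<Union>(T ` {..<N}) = pt ` (\<Union>k<2 * (n - 1). strip col k)"
    by (auto simp: T_def N_def)
  also have "\<dots> = insert (pt (0, 0)) (insert u (pt ` V))"
    using Union_strip[of col "n - 1"] col step n last ab
    by (simp add: V_def u_def n_def insert_commute of_nat_diff)
  finally have vertices: "\<Union>(crossed_triangles u) = insert 0 (insert u (pt ` V))"
    by (simp add: crossed lattice_point_def)
  have "(0, 0) \<notin> V" "(int a, int b) \<notin> V"
    using level[of 0 0] level[of "int a" "int b"] by (auto simp: n_def)
  then have "pt (0, 0) \<notin> pt ` V" "u \<notin> pt ` V"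
    by (simp_all add: u_def inj_image_mem_iff[OF inj_pt])
  then have notin: "0 \<notin> pt ` V" "u \<notin> pt ` V"
    by (simp_all add: lattice_point_def)
  have G: "G_vertices u = Inl ` (pt ` V) \<union> Inr ` T ` {..<N}"
    "G_edges u = incidences T N (pt ` V)"
  proof -
    show "G_vertices u = Inl ` (pt ` V) \<union> Inr ` T ` {..<N}"
    proof -
      have "Inl ` insert 0 (insert u W) \<union> Inr ` X - {Inl 0, Inl u} = Inl ` W \<union> Inr ` X"
        if "0 \<notin> W" "u \<notin> W" for W and X :: "(real^3) set set"
        using that by auto
      from this[OF notin] show ?thesis
        unfolding G_vertices_def incidence_vertices_def vertices by (simp only: crossed)
    qed
    have mem: "p \<in> pt ` V \<longleftrightarrow> p \<noteq> 0 \<and> p \<noteq> u" if "k < N" "p \<in> T k" for p k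
    proof -
      have "p \<in> insert 0 (insert u (pt ` V))"
        unfolding vertices[symmetric] crossed using that by blast
      then show ?thesis using notin by auto
    qed
    have "incidence_edges u = {{Inl p, Inr (T k)} |p k. k < N \<and> p \<in> T k}"
      unfolding incidence_edges_def crossed by blast
    then have "G_edges u = {{Inl p, Inr (T k)} |p k. k < N \<and> p \<in> T k \<and> p \<noteq> 0 \<and> p \<noteq> u}"
      unfolding G_edges_def by auto
    also have "\<dots> = incidences T N (pt ` V)"
      by (simp add: incidences_def mem cong: conj_cong)
    finally show "G_edges u = incidences T N (pt ` V)" .
  qed
  have "inj_on T {..<N}"
    by (auto simp: inj_on_def T_def inj_image_eq_iff[OF inj_pt] strip_inject)
  moreover have "finite V" by (simp add: V_def strip_vertices_def)
  ultimately have "card {P. perfect_matching (G_vertices u) (G_edges u) P} = transversals T N (pt ` V)"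
    unfolding G by (intro card_perfect_matchings) (auto simp: T_def finite_strip)
  also have "\<dots> = transversals (strip col) (2 * (n - 1)) V"
    unfolding T_def N_def by (rule transversals_image[OF inj_pt])
  also have "int \<dots> = word_matrix (\<lambda>m. col m \<noteq> col (Suc m)) (Suc (n - 1)) $ 1 $ 2"
    unfolding V_def using col step last all n ab by (intro strip_transversals) auto
  also have "\<dots> = cohn a b"
  proof -
    have "(\<lambda>m. col m \<noteq> col (Suc m)) = christoffel a (a + b)" "Suc (n - 1) = a + b"
      using n by (simp_all add: christoffel_def fun_eq_iff n_def)
    then show ?thesis by (simp only: cohn_def cohn_matrix_def)
  qed
  finally have "int (card {P. perfect_matching (G_vertices u) (G_edges u) P}) = cohn a b" .
  moreover have "u \<notin> shortest_vectors tri_lattice"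
  proof -
    have "(int a, int b) \<notin> hexagon" using ab by (auto simp: hexagon_def)
    moreover have "shortest_vectors tri_lattice = pt ` hexagon"
      using sector unfolding sector_def by (elim conjE)
    ultimately show ?thesis
      by (simp only: u_def inj_image_mem_iff[OF inj_pt] not_False_eq_True)
  qed
  ultimately show ?thesis by (simp add: matching_number_def u_def)
qed

end

text \<open>On the boundary of the sector coprimality leaves only the two spanning shortest vectors,
  where the convention M = 1 agrees with the matrix entry.\<close>

lemma matching_number_pt:
  assumes "coprime a b"
  shows "int (matching_number (pt (int a, int b))) = cohn a b"
proof (cases "a > 0 \<and> b > 0")
  case True
  then show ?thesis using matching_number_pt_pos assms by simp
next
  case False
  then have "(a, b) = (1, 0) \<or> (a, b) = (0, 1)" using assms by auto
  moreover have "pt (int a, int b) \<in> shortest_vectors tri_lattice" "cohn a b = 1"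
    using calculation sector cohn_1_0 cohn_0_1 by (auto simp: sector_def hexagon_def)
  ultimately show ?thesis by (simp add: matching_number_def)
qed

end

section \<open>Superbases and Markoff triples\<close>

lemma markoff_triple_int:
  "markoff_triple x y z \<longleftrightarrow> int x > 0 \<and> int y > 0 \<and> int z > 0 \<and>
    (int x)\<^sup>2 + (int y)\<^sup>2 + (int z)\<^sup>2 = 3 * int x * int y * int z"
proof -
  have "x\<^sup>2 + y\<^sup>2 + z\<^sup>2 = 3 * x * y * z \<longleftrightarrow> int (x\<^sup>2 + y\<^sup>2 + z\<^sup>2) = int (3 * x * y * z)"
    by (simp only: of_nat_eq_iff)
  then show ?thesis by (simp add: markoff_triple_def)
qed

lemma markoff_triple_perm:
  assumes "markoff_triple x y z"
  shows "markoff_triple y x z" "markoff_triple x z y"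
  using assms by (auto simp: markoff_triple_def algebra_simps)

lemma lax_eq_iff: "lax u = lax v \<longleftrightarrow> u = v \<or> u = - v" for u v :: "'a::real_vector"
  by (auto simp: lax_def doubleton_eq_iff)

lemma sector_coordinates:
  assumes "sector e f" "u \<in> tri_lattice"
  obtains x y where "u = lattice_point e f (x, y)"
proof -
  have "u \<in> range (lattice_point e f)" using assms unfolding sector_def by simp
  then show thesis using that by (metis imageE prod.exhaust)
qed

definition det2 :: "int \<times> int \<Rightarrow> int \<times> int \<Rightarrow> int" where
  "det2 c d = fst c * snd d - snd c * fst d"

lemma coprime_of_det2:
  assumes "\<bar>det2 c d\<bar> = 1"
  shows "coprime (fst c) (snd c)"
proof (rule coprimeI)
  fix g assume "g dvd fst c" "g dvd snd c"
  then have "g dvd det2 c d" by (simp add: det2_def)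
  then show "is_unit g" using assms by (metis dvd_abs_iff)
qed

context
  fixes e f :: "real^3"
  assumes sector: "sector e f"
begin

abbreviation "lat \<equiv> lattice_point e f"

lemma lattice_range: "tri_lattice = range lat"
  using sector by (simp add: sector_def)

lemma lat_eq_iff: "lat c = lat d \<longleftrightarrow> c = d"
  by (rule pt_eq_iff[OF sector])

lemma lat_scale: "of_int k *\<^sub>R lat (x, y) = lat (k * x, k * y)"
  by (simp add: lattice_point_def scaleR_right_distrib)

lemma primitive_iff: "primitive_vector tri_lattice (lat (x, y)) \<longleftrightarrow> coprime x y"
proof -
  have "primitive_vector tri_lattice (lat (x, y)) \<longleftrightarrow>
      \<not> (\<exists>k>1. \<exists>x' y'. x = k * x' \<and> y = k * y')"
    unfolding primitive_vector_def lattice_range by (auto simp: lat_scale lat_eq_iff)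
  also have "\<dots> \<longleftrightarrow> coprime x y"
  proof
    assume *: "\<not> (\<exists>k>1. \<exists>x' y'. x = k * x' \<and> y = k * y')"
    have "gcd x y \<noteq> 0"
    proof
      assume "gcd x y = 0"
      then have "x = 2 * 0 \<and> y = 2 * 0" by simp
      then show False using * by (metis one_less_numeral_iff semiring_norm(76))
    qed
    moreover have "\<not> gcd x y > 1"
      using * by (metis dvdE gcd_dvd1 gcd_dvd2)
    moreover have "gcd x y \<ge> 0" by simp
    ultimately have "gcd x y = 1" by linarith
    then show "coprime x y" by (simp add: coprime_iff_gcd_eq_1)
  next
    assume "coprime x y"
    show "\<not> (\<exists>k>1. \<exists>x' y'. x = k * x' \<and> y = k * y')"
    proof
      assume "\<exists>k>1. \<exists>x' y'. x = k * x' \<and> y = k * y'"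
      then obtain k where "k > 1" "k dvd x" "k dvd y" by auto
      then have "is_unit k" using \<open>coprime x y\<close> by (meson coprime_common_divisor)
      then show False using \<open>k > 1\<close> by simp
    qed
  qed
  finally show ?thesis .
qed

lemma lattice_basis_iff: "lattice_basis tri_lattice (lat c) (lat d) \<longleftrightarrow> \<bar>det2 c d\<bar> = 1"
proof -
  obtain c1 c2 d1 d2 where cd: "c = (c1, c2)" "d = (d1, d2)" by (metis prod.exhaust)
  have comb: "lat p = of_int k *\<^sub>R lat c + of_int l *\<^sub>R lat d \<longleftrightarrow> p = (k * c1 + l * d1, k * c2 + l * d2)" for p k l
  proof -
    have "of_int k *\<^sub>R lat c + of_int l *\<^sub>R lat d = lat ((k * c1, k * c2) + (l * d1, l * d2))"
      unfolding lattice_point_add cd lat_scale ..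
    then show ?thesis by (simp add: lat_eq_iff)
  qed
  have iff: "lattice_basis tri_lattice (lat c) (lat d) \<longleftrightarrow>
      (\<forall>p. \<exists>!kl. p = (fst kl * c1 + snd kl * d1, fst kl * c2 + snd kl * d2))"
    unfolding lattice_basis_def lattice_range by (simp add: comb)
  show ?thesis
  proof
    assume "lattice_basis tri_lattice (lat c) (lat d)"
    then obtain k l k' l' where "(1, 0) = (k * c1 + l * d1, k * c2 + l * d2)"
      "(0, 1) = (k' * c1 + l' * d1, k' * c2 + l' * d2)"
      unfolding iff by (metis ex1_implies_ex)
    \<comment> \<open>Expressing the standard basis through c and d inverts the matrix, and
      determinants multiply.\<close>
    then have "(c1 * d2 - c2 * d1) * (k * l' - l * k') = 1"
      by simp algebra
    then show "\<bar>det2 c d\<bar> = 1"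
      by (metis abs_zmult_eq_1 abs_one cd det2_def fst_conv snd_conv)
  next
    assume "\<bar>det2 c d\<bar> = 1"
    \<comment> \<open>\<open>D\<close> is the inverse of the determinant in the integers; Cramer's
      rule then gives unique integer coordinates.\<close>
    then obtain D where D: "D * (c1 * d2 - c2 * d1) = 1"
      by (auto simp: det2_def cd abs_if split: if_splits intro: that[of 1] that[of "-1"])
    have comb_iff: "p = (k * c1 + l * d1, k * c2 + l * d2) \<longleftrightarrow>
        (k, l) = (D * (fst p * d2 - snd p * d1), D * (c1 * snd p - c2 * fst p))" for p k l
    proof
      assume "p = (k * c1 + l * d1, k * c2 + l * d2)"
      then have p: "fst p = k * c1 + l * d1" "snd p = k * c2 + l * d2" by simp_all
      have "D * (fst p * d2 - snd p * d1) = k * (D * (c1 * d2 - c2 * d1))"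
        "D * (c1 * snd p - c2 * fst p) = l * (D * (c1 * d2 - c2 * d1))"
        unfolding p by (simp_all add: algebra_simps)
      then show "(k, l) = (D * (fst p * d2 - snd p * d1), D * (c1 * snd p - c2 * fst p))"
        unfolding D by simp
    next
      assume "(k, l) = (D * (fst p * d2 - snd p * d1), D * (c1 * snd p - c2 * fst p))"
      then have kl: "k = D * (fst p * d2 - snd p * d1)" "l = D * (c1 * snd p - c2 * fst p)" by simp_all
      have "k * c1 + l * d1 = fst p * (D * (c1 * d2 - c2 * d1))"
        "k * c2 + l * d2 = snd p * (D * (c1 * d2 - c2 * d1))"
        unfolding kl by (simp_all add: algebra_simps)
      then show "p = (k * c1 + l * d1, k * c2 + l * d2)"
        unfolding D by (simp add: prod_eq_iff)
    qed
    show "lattice_basis tri_lattice (lat c) (lat d)"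
      unfolding iff by (simp only: comb_iff prod.collapse) simp
  qed
qed

lemma lax_superbase_lat:
  assumes "\<bar>det2 c d\<bar> = 1"
  shows "lax_superbase tri_lattice {lax (lat c), lax (lat d), lax (lat (c + d))}"
proof -
  have det: "\<bar>det2 d c\<bar> = 1" "\<bar>det2 d (c + d)\<bar> = 1" "\<bar>det2 c (c + d)\<bar> = 1" "\<bar>det2 (c + d) c\<bar> = 1"
    using assms by (auto simp: det2_def algebra_simps)
  have "lax (lat p) \<noteq> lax (lat q)" if "\<bar>det2 p q\<bar> = 1" for p q
    using that by (auto simp: lax_eq_iff lat_eq_iff det2_def simp flip: lattice_point_minus)
  then have "card {lax (lat c), lax (lat d), lax (lat (c + d))} = 3"
    using assms det by (simp add: card_insert_if)
  moreover have "primitive_vector tri_lattice (lat c)" "primitive_vector tri_lattice (lat d)"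
    "primitive_vector tri_lattice (lat (c + d))"
    using coprime_of_det2[OF assms] coprime_of_det2[OF det(1)] coprime_of_det2[OF det(4)]
    by (simp_all only: primitive_iff[symmetric] prod.collapse)
  moreover have "1 *\<^sub>R lat c + 1 *\<^sub>R lat d + (- 1) *\<^sub>R lat (c + d) = 0"
    by (simp add: lattice_point_add)
  ultimately show ?thesis
    unfolding lax_superbase_def using assms det lattice_basis_iff by blast
qed

end

text \<open>One sector, its first two rotations and their negatives cover the plane; the case split
  runs through these six cones.\<close>

lemma sector_of_vector:
  assumes "u \<in> tri_lattice"
  shows "\<exists>e f a b. sector e f \<and> u = lattice_point e f (int a, int b)"
proof -
  obtain e f where s: "sector e f" using sector_base by blast
  obtain x y where u: "u = lattice_point e f (x, y)"
    using s assms by (rule sector_coordinates)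
  have pos: ?thesis if "sector e' f'" "u = lattice_point e' f' (x', y')" "x' \<ge> 0" "y' \<ge> 0" for e' f' x' y'
    using that by (metis int_nat_eq)
  note s1 = sector_rotate[OF s]
  note s2 = sector_rotate[OF s1]
  consider "x \<ge> 0" "y \<ge> 0" | "x \<le> 0" "y \<le> 0" | "x \<le> 0" "x + y \<ge> 0" | "x \<ge> 0" "x + y \<le> 0"
    | "y \<ge> 0" "x + y \<le> 0" | "y \<le> 0" "x + y \<ge> 0"
    by linarith
  then show ?thesis
  proof cases
    case 1
    then show ?thesis using pos[OF s u] by simp
  next
    case 2
    then show ?thesis
      using pos[OF sector_minus[OF s], of "- x" "- y"] by (simp add: u lattice_point_def)
  next
    case 3
    then show ?thesis
      using pos[OF s1, of "x + y" "- x"] by (simp add: u lattice_point_def algebra_simps)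
  next
    case 4
    then show ?thesis
      using pos[OF sector_minus[OF s1], of "- x - y" "x"] by (simp add: u lattice_point_def algebra_simps)
  next
    case 5
    then show ?thesis
      using pos[OF s2, of "y" "- x - y"] by (simp add: u lattice_point_def algebra_simps)
  next
    case 6
    then show ?thesis
      using pos[OF sector_minus[OF s2], of "- y" "x + y"] by (simp add: u lattice_point_def algebra_simps)
  qed
qed

lemma matching_number_minus:
  assumes "primitive_vector tri_lattice u"
  shows "matching_number (- u) = matching_number u"
proof -
  obtain e f and a b :: nat where s: "sector e f" and u: "u = lattice_point e f (int a, int b)"
    using assms sector_of_vector unfolding primitive_vector_def by blast
  have ab: "coprime a b" using assms primitive_iff[OF s, of "int a" "int b"] by (simp add: u)
  have "- u = lattice_point (- e) (- f) (int a, int b)" by (simp add: u lattice_point_def)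
  then have "int (matching_number (- u)) = int (matching_number u)"
    using matching_number_pt[OF s ab] matching_number_pt[OF sector_minus[OF s] ab] by (simp add: u)
  then show ?thesis by simp
qed

section \<open>Moving a basis into a single sector\<close>

definition unimodular :: "nat \<Rightarrow> nat \<Rightarrow> nat \<Rightarrow> nat \<Rightarrow> bool" where
  "unimodular a b c d \<longleftrightarrow> \<bar>det2 (int a, int b) (int c, int d)\<bar> = 1"

lemma unimodular_iff: "unimodular a b c d \<longleftrightarrow> a * d = c * b + 1 \<or> c * b = a * d + 1"
proof -
  have "unimodular a b c d \<longleftrightarrow> int (a * d) = int (c * b + 1) \<or> int (c * b) = int (a * d + 1)"
    by (auto simp: unimodular_def det2_def algebra_simps)
  then show ?thesis by (simp only: of_nat_eq_iff)
qed

definition in_common_sector :: "real^3 \<Rightarrow> real^3 \<Rightarrow> bool" where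
  "in_common_sector u v \<longleftrightarrow> (\<exists>e f a b c d. sector e f \<and> unimodular a b c d \<and>
     lax u = lax (lattice_point e f (int a, int b)) \<and> lax v = lax (lattice_point e f (int c, int d)))"

lemma same_sign_sector:
  assumes s: "sector e f" and det: "\<bar>det2 (x1, y1) (x2, y2)\<bar> = 1"
    and "x1 * y1 \<ge> 0" "x2 * y2 \<ge> 0"
    and u: "lax u = lax (lattice_point e f (x1, y1))" and v: "lax v = lax (lattice_point e f (x2, y2))"
  shows "in_common_sector u v"
proof -
  have sgn: "(x, y) = (\<bar>x\<bar>, \<bar>y\<bar>) \<or> (x, y) = - (\<bar>x\<bar>, \<bar>y\<bar>)" if "x * y \<ge> 0" for x y :: int
    using that by (auto simp: zero_le_mult_iff)
  have lax: "lax (lattice_point e f (x, y)) = lax (lattice_point e f (\<bar>x\<bar>, \<bar>y\<bar>))" if "x * y \<ge> 0" for x y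
    using sgn[OF that] by (metis lattice_point_minus lax_eq_iff)
  have "\<bar>det2 (\<bar>x1\<bar>, \<bar>y1\<bar>) (\<bar>x2\<bar>, \<bar>y2\<bar>)\<bar> = 1"
    using sgn[OF assms(3)] sgn[OF assms(4)] det by (auto simp: det2_def)
  then have "unimodular (nat \<bar>x1\<bar>) (nat \<bar>y1\<bar>) (nat \<bar>x2\<bar>) (nat \<bar>y2\<bar>)"
    by (simp add: unimodular_def)
  moreover have "lax u = lax (lattice_point e f (int (nat \<bar>x1\<bar>), int (nat \<bar>y1\<bar>)))"
    "lax v = lax (lattice_point e f (int (nat \<bar>x2\<bar>), int (nat \<bar>y2\<bar>)))"
    using lax[OF assms(3)] lax[OF assms(4)] by (simp_all only: u v int_nat_eq abs_ge_zero if_True)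
  ultimately show ?thesis using s unfolding in_common_sector_def by blast
qed

lemma basis_in_common_sector:
  assumes "lattice_basis tri_lattice u v"
  shows "in_common_sector u v"
proof -
  obtain e f where s: "sector e f" using sector_base by blast
  obtain x1 y1 where u: "u = lattice_point e f (x1, y1)"
    using assms sector_coordinates[OF s] unfolding lattice_basis_def by blast
  obtain x2 y2 where v: "v = lattice_point e f (x2, y2)"
    using assms sector_coordinates[OF s] unfolding lattice_basis_def by blast
  have det: "\<bar>x1 * y2 - y1 * x2\<bar> = 1"
    using assms lattice_basis_iff[OF s] by (simp add: u v det2_def)
  \<comment> \<open>Here the two products in the determinant have opposite signs, so its absolute
    value is at least 2.\<close>
  have crossing: False if "x1 * y1 > 0" "x2 * y2 < 0" "\<bar>x1 * y2 - y1 * x2\<bar> = 1" for x1 y1 x2 y2 :: int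
  proof -
    have "(x1 * y2) * (y1 * x2) < 0"
      using mult_pos_neg[OF that(1,2)] by (simp add: mult_ac)
    then have "x1 * y2 > 0 \<and> y1 * x2 < 0 \<or> x1 * y2 < 0 \<and> y1 * x2 > 0"
      by (simp only: mult_less_0_iff[of "x1 * y2"])
    then show False using that(3) by linarith
  qed
  consider "x1 * y1 \<ge> 0" "x2 * y2 \<ge> 0" | "x1 * y1 \<le> 0" "x2 * y2 \<le> 0"
    | "x1 * y1 > 0" "x2 * y2 < 0" | "x2 * y2 > 0" "x1 * y1 < 0"
    by linarith
  then show ?thesis
  proof cases
    case 1
    then show ?thesis using same_sign_sector[OF s] det u v by (simp add: det2_def)
  next
    \<comment> \<open>Up to sign both vectors lie in the cone of 120 degrees from e to -f, which e -
      f bisects into the two sectors \<open>s1\<close> and \<open>s2\<close>.\<close>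
    case 2
    define a b c d where "a = \<bar>x1\<bar>" "b = \<bar>y1\<bar>" "c = \<bar>x2\<bar>" "d = \<bar>y2\<bar>"
    have sgn: "(x, y) = (\<bar>x\<bar>, - \<bar>y\<bar>) \<or> (x, y) = - (\<bar>x\<bar>, - \<bar>y\<bar>)" if "x * y \<le> 0" for x y :: int
      using that by (auto simp: mult_le_0_iff)
    have lax: "lax u = lax (lattice_point e f (a, - b))" "lax v = lax (lattice_point e f (c, - d))"
      using sgn[OF 2(1)] sgn[OF 2(2)] unfolding u v a_b_c_d_def by (metis lattice_point_minus lax_eq_iff)+
    have abcd: "\<bar>a * d - b * c\<bar> = 1"
      using sgn[OF 2(1)] sgn[OF 2(2)] det by (auto simp: a_b_c_d_def)
    have nonneg: "a \<ge> 0" "b \<ge> 0" "c \<ge> 0" "d \<ge> 0" by (auto simp: a_b_c_d_def)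
    have s1: "sector (e - f) (- f)" using sector_swap[OF sector_minus[OF sector_rotate[OF s]]] by simp
    have s2: "sector e (e - f)" using sector_swap[OF sector_minus[OF sector_rotate[OF sector_rotate[OF s]]]] by simp
    have p1: "lattice_point e f (a, - b) = lattice_point (e - f) (- f) (a, b - a)" for a b
      by (simp add: lattice_point_def algebra_simps)
    have p2: "lattice_point e f (a, - b) = lattice_point e (e - f) (a - b, b)" for a b
      by (simp add: lattice_point_def algebra_simps)
    \<comment> \<open>Vectors strictly on different sides of the bisector have determinant at least
      b + c + 1, so they can only be e and -f, which up to sign span the original sector.\<close>
    have bound: "b = 0 \<and> c = 0 \<and> a = 1 \<and> d = 1" if "a > b" "d > c" "b \<ge> 0" "c \<ge> 0" "\<bar>a * d - b * c\<bar> = 1"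
      for a b c d :: int
    proof -
      have "(b + 1) * (c + 1) \<le> a * d" using that by (intro mult_mono) auto
      then have "b + c + 1 \<le> a * d - b * c" by (simp add: algebra_simps)
      then have bc: "b = 0" "c = 0" using that by linarith+
      then have "a * d = 1" using that by simp
      then show ?thesis using that bc by (simp add: zmult_eq_1_iff)
    qed
    consider "a \<ge> b" "c \<ge> d" | "a \<le> b" "c \<le> d" | "a > b" "d > c" | "b > a" "c > d" by linarith
    then show ?thesis
    proof cases
      case 1
      then have "(a - b) * b \<ge> 0" "(c - d) * d \<ge> 0" using nonneg by simp_all
      moreover have "\<bar>det2 (a - b, b) (c - d, d)\<bar> = 1"
        using abcd by (simp add: det2_def algebra_simps)
      ultimately show ?thesis using same_sign_sector[OF s2] lax[unfolded p2] by blast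
    next
      case 2
      then have "a * (b - a) \<ge> 0" "c * (d - c) \<ge> 0" using nonneg by simp_all
      moreover have "\<bar>det2 (a, b - a) (c, d - c)\<bar> = 1"
        using abcd by (simp add: det2_def algebra_simps)
      ultimately show ?thesis using same_sign_sector[OF s1] lax[unfolded p1] by blast
    next
      case 3
      then have "b = 0 \<and> c = 0 \<and> a = 1 \<and> d = 1" using bound abcd nonneg by blast
      then show ?thesis
        using lax by (intro same_sign_sector[OF s, of a "- b" c "- d"]) (simp_all add: det2_def)
    next
      case 4
      moreover have "\<bar>b * c - a * d\<bar> = 1" using abcd by linarith
      ultimately have "a = 0 \<and> d = 0 \<and> b = 1 \<and> c = 1" using bound nonneg by blast
      then show ?thesis
        using lax by (intro same_sign_sector[OF s, of a "- b" c "- d"]) (simp_all add: det2_def)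
    qed
  next
    case 3
    then show ?thesis using crossing[of x1 y1 x2 y2] det by simp
  next
    case 4
    then show ?thesis using crossing[of x2 y2 x1 y1] det by (simp add: algebra_simps abs_minus_commute)
  qed
qed

lemma matching_number_lax:
  assumes "primitive_vector tri_lattice u" "lax v = lax u"
  shows "matching_number v = matching_number u"
proof -
  have "v = u \<or> v = - u" using assms(2) by (simp only: lax_eq_iff)
  then show ?thesis using matching_number_minus[OF assms(1)] by auto
qed

section \<open>From superbases to Markoff triples\<close>

lemma markoff_cohn:
  assumes "sector e f" "unimodular a b c d"
  shows "markoff_triple (matching_number (lattice_point e f (int a, int b)))
    (matching_number (lattice_point e f (int c, int d)))
    (matching_number (lattice_point e f (int (a + c), int (b + d))))"
proof -
  have det: "\<bar>det2 (int a, int b) (int c, int d)\<bar> = 1" "\<bar>det2 (int c, int d) (int a, int b)\<bar> = 1"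
    "\<bar>det2 (int (a + c), int (b + d)) (int a, int b)\<bar> = 1"
    using assms(2) by (auto simp: unimodular_def det2_def algebra_simps abs_minus_commute)
  have "coprime a b" "coprime c d" "coprime (a + c) (b + d)"
    using coprime_of_det2[OF det(1)] coprime_of_det2[OF det(2)] coprime_of_det2[OF det(3)]
    by (simp_all only: fst_conv snd_conv coprime_int_iff)
  note M = this[THEN matching_number_pt[OF assms(1)]]
  from assms(2) have "a * d = c * b + 1 \<or> c * b = a * d + 1" by (simp add: unimodular_iff)
  then show ?thesis
  proof
    assume "a * d = c * b + 1"
    from cohn_markoff[OF this] show ?thesis unfolding markoff_triple_int M by auto
  next
    assume "c * b = a * d + 1"
    from cohn_markoff[OF this] show ?thesis
      unfolding markoff_triple_int M by (auto simp: algebra_simps)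
  qed
qed

text \<open>If one vector dominates, it is the sum of the other and the difference, up to sign, and
  \<open>markoff_cohn\<close> applies to these. Otherwise the pair is the standard basis in some
  order, all three vectors are shortest, and the triple is (1, 1, 1).\<close>

lemma markoff_cohn_diff:
  assumes s: "sector e f" and uni: "unimodular a b c d"
  shows "markoff_triple (matching_number (lattice_point e f (int a, int b)))
    (matching_number (lattice_point e f (int c, int d)))
    (matching_number (lattice_point e f (int a - int c, int b - int d)))"
    (is "markoff_triple ?x ?y ?z")
proof -
  consider "c \<le> a" "d \<le> b" | "a \<le> c" "b \<le> d" | "c < a" "b < d" | "a < c" "d < b"
    by linarith
  then show ?thesis
  proof cases
    case 1
    then have "unimodular (a - c) (b - d) c d"
      using uni by (simp add: unimodular_def det2_def algebra_simps)
    from markoff_cohn[OF s this] have "markoff_triple ?z ?y ?x"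
      using 1 by simp
    then show ?thesis by (metis markoff_triple_perm)
  next
    case 2
    then have uni': "unimodular a b (c - a) (d - b)"
      using uni by (simp add: unimodular_def det2_def algebra_simps)
    have "\<bar>det2 (int a - int c, int b - int d) (int a, int b)\<bar> = 1"
      using uni by (simp add: unimodular_def det2_def algebra_simps abs_minus_commute)
    from coprime_of_det2[OF this] have "primitive_vector tri_lattice (lattice_point e f (int a - int c, int b - int d))"
      by (simp add: primitive_iff[OF s])
    moreover have "lattice_point e f (int (c - a), int (d - b)) = - lattice_point e f (int a - int c, int b - int d)"
      using 2 by (simp add: algebra_simps flip: lattice_point_minus)
    ultimately have "matching_number (lattice_point e f (int (c - a), int (d - b))) = ?z"
      using matching_number_minus by simp
    moreover have "a + (c - a) = c" "b + (d - b) = d" using 2 by simp_all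
    ultimately have "markoff_triple ?x ?z ?y"
      using markoff_cohn[OF s uni'] by simp
    then show ?thesis by (metis markoff_triple_perm)
  next
    case 3
    then have "(c + 1) * (b + 1) \<le> a * d" by (intro mult_mono) auto
    then have bc: "c = 0" "b = 0" "a * d = 1"
      using uni by (auto simp: unimodular_iff algebra_simps)
    then have "(int a, int b) \<in> hexagon" "(int c, int d) \<in> hexagon"
      "(int a - int c, int b - int d) \<in> hexagon" by (auto simp: hexagon_def)
    then have "?x = 1" "?y = 1" "?z = 1"
      using s by (simp_all add: matching_number_def sector_def)
    then show ?thesis by (simp add: markoff_triple_def)
  next
    case 4
    then have "(a + 1) * (d + 1) \<le> c * b" by (intro mult_mono) auto
    then have bc: "a = 0" "d = 0" "c * b = 1"
      using uni by (auto simp: unimodular_iff algebra_simps)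
    then have "(int a, int b) \<in> hexagon" "(int c, int d) \<in> hexagon"
      "(int a - int c, int b - int d) \<in> hexagon" by (auto simp: hexagon_def)
    then have "?x = 1" "?y = 1" "?z = 1"
      using s by (simp_all add: matching_number_def sector_def)
    then show ?thesis by (simp add: markoff_triple_def)
  qed
qed

lemma markoff_basis:
  assumes "lattice_basis tri_lattice u v" "primitive_vector tri_lattice u" "primitive_vector tri_lattice v"
    "primitive_vector tri_lattice w" and w: "lax w = lax (u + v) \<or> lax w = lax (u - v)"
  shows "markoff_triple (matching_number u) (matching_number v) (matching_number w)"
proof -
  obtain e f and a b c d :: nat where s: "sector e f" and uni: "unimodular a b c d"
    and u: "lax u = lax (lattice_point e f (int a, int b))" (is "_ = lax ?U")
    and v: "lax v = lax (lattice_point e f (int c, int d))" (is "_ = lax ?V")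
    using basis_in_common_sector[OF assms(1)] unfolding in_common_sector_def by blast
  \<comment> \<open>Replacing u or v by its negative may exchange sum and difference, so both cases
    have to be kept.\<close>
  have "lax w = lax (?U + ?V) \<or> lax w = lax (?U - ?V)"
    using u v w by (auto simp: lax_eq_iff)
  moreover have "?U + ?V = lattice_point e f (int (a + c), int (b + d))"
    "?U - ?V = lattice_point e f (int a - int c, int b - int d)"
    by (simp_all flip: lattice_point_add lattice_point_diff)
  ultimately have "matching_number w = matching_number (lattice_point e f (int (a + c), int (b + d))) \<or>
      matching_number w = matching_number (lattice_point e f (int a - int c, int b - int d))"
    using matching_number_lax[OF assms(4)] by metis
  moreover have "matching_number u = matching_number ?U" "matching_number v = matching_number ?V"
    using matching_number_lax u v assms(2,3) by metis+
  ultimately show ?thesis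
    using markoff_cohn[OF s uni] markoff_cohn_diff[OF s uni] by metis
qed

lemma set3_eq_cases:
  assumes "{x, y, z} = {x', y', z'}" "card {x, y, z} = 3"
  shows "(x, y, z) \<in> {(x', y', z'), (x', z', y'), (y', x', z'), (y', z', x'), (z', x', y'), (z', y', x')}"
proof -
  have "x \<noteq> y" "y \<noteq> z" "x \<noteq> z"
    using assms(2) by (auto simp: card_insert_if split: if_splits)
  moreover have "x \<in> {x', y', z'}" "y \<in> {x', y', z'}" "z \<in> {x', y', z'}"
    using assms(1) by blast+
  ultimately show ?thesis by auto
qed

text \<open>The definition of a superbase only supplies some representatives in some order.
  Invariance of M under signs and symmetry of the Markoff equation carry the result over to the
  given ones.\<close>

lemma markoff_superbase:
  assumes "lax_superbase tri_lattice {lax u, lax v, lax w}"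
  shows "markoff_triple (matching_number u) (matching_number v) (matching_number w)"
    and "primitive_vector tri_lattice u"
proof -
  obtain u' v' w' a b c where S: "{lax u, lax v, lax w} = {lax u', lax v', lax w'}"
    and card: "card {lax u, lax v, lax w} = 3"
    and prim: "primitive_vector tri_lattice u'" "primitive_vector tri_lattice v'" "primitive_vector tri_lattice w'"
    and abc: "a \<in> {1, - 1}" "b \<in> {1, - 1}" "c \<in> {1, - 1 :: real}" "a *\<^sub>R u' + b *\<^sub>R v' + c *\<^sub>R w' = 0"
    and basis: "lattice_basis tri_lattice u' v'"
    using assms unfolding lax_superbase_def by (elim conjE exE bexE)
  \<comment> \<open>Solving the sign relation for \<open>w'\<close> leaves the sum or the difference
    of \<open>u'\<close> and \<open>v'\<close>, up to sign.\<close>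
  have "c *\<^sub>R w' = - (a *\<^sub>R u' + b *\<^sub>R v')"
    using abc(4) by (metis add.inverse_unique add.commute)
  then have "c *\<^sub>R c *\<^sub>R w' = c *\<^sub>R (- (a *\<^sub>R u' + b *\<^sub>R v'))" by simp
  moreover have "c *\<^sub>R c *\<^sub>R w' = w'" using abc(3) by auto
  ultimately have "w' = c *\<^sub>R (- (a *\<^sub>R u' + b *\<^sub>R v'))" by simp
  then have "w' = u' + v' \<or> w' = - (u' + v') \<or> w' = u' - v' \<or> w' = - (u' - v')"
    using abc(1-3) by auto
  then have "lax w' = lax (u' + v') \<or> lax w' = lax (u' - v')"
    by (auto simp only: lax_eq_iff)
  from markoff_basis[OF basis prim this]
  have M: "markoff_triple (matching_number u') (matching_number v') (matching_number w')" .
  note cases = set3_eq_cases[OF S card]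
  have lax: "matching_number p = matching_number q" if "lax p = lax q" "q \<in> {u', v', w'}" for p q
    using that prim matching_number_lax by blast
  show "markoff_triple (matching_number u) (matching_number v) (matching_number w)"
  proof -
    have transfer: "markoff_triple (matching_number u) (matching_number v) (matching_number w)"
      if "lax u = lax p" "lax v = lax q" "lax w = lax r" "{p, q, r} \<subseteq> {u', v', w'}"
        "markoff_triple (matching_number p) (matching_number q) (matching_number r)" for p q r
      using that lax[of u p] lax[of v q] lax[of w r] by simp
    note perms = M markoff_triple_perm[OF M] markoff_triple_perm(2)[OF markoff_triple_perm(1)[OF M]]
      markoff_triple_perm(1)[OF markoff_triple_perm(2)[OF M]]
      markoff_triple_perm(1)[OF markoff_triple_perm(2)[OF markoff_triple_perm(1)[OF M]]]
    from cases show ?thesis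
      by (elim insertE emptyE; elim Pair_inject) (rule transfer; (assumption | rule perms | simp))+
  qed
  have "lax u = lax u' \<or> lax u = lax v' \<or> lax u = lax w'" using S by blast
  moreover have "primitive_vector tri_lattice p"
    if lax: "lax p = lax q" and q_prim: "primitive_vector tri_lattice q" for p q
  proof -
    obtain e f where s: "sector e f" using sector_base by blast
    obtain x y where q: "q = lattice_point e f (x, y)"
      using q_prim sector_coordinates[OF s] unfolding primitive_vector_def by blast
    then have "p = lattice_point e f (x, y) \<or> p = lattice_point e f (- x, - y)"
      using lax by (auto simp: lax_eq_iff simp flip: lattice_point_minus)
    then show ?thesis using q_prim primitive_iff[OF s] by (auto simp: q)
  qed
  ultimately show "primitive_vector tri_lattice u" using prim by blast
qed

section \<open>Descent: every Markoff triple arises\<close>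

lemma markoff_descent:
  fixes p q r :: int
  assumes "p > 0" "q > 0" "p\<^sup>2 + q\<^sup>2 + r\<^sup>2 = 3 * p * q * r" "p \<le> q" "q \<le> r" "q > 1"
  shows "0 < 3 * p * q - r" "3 * p * q - r \<le> q" "q < r"
    "p\<^sup>2 + (3 * p * q - r)\<^sup>2 + q\<^sup>2 = 3 * p * (3 * p * q - r) * q"
proof -
  \<comment> \<open>r and 3 p q - r are the roots of t^2 - 3 p q t + p^2 + q^2, whose constant term
    is their product.\<close>
  have prod: "r * (3 * p * q - r) = p\<^sup>2 + q\<^sup>2" using assms(3) by algebra
  have "p\<^sup>2 + q\<^sup>2 > 0" using assms by (simp add: sum_power2_gt_zero_iff)
  then show "0 < 3 * p * q - r" using prod assms by (metis zero_less_mult_pos less_le_trans)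
  \<comment> \<open>Up to sign this is that quadratic at t = q; a positive value of the product
    places q strictly between the roots, with r the larger.\<close>
  have f: "(r - q) * (q - (3 * p * q - r)) = 3 * p * q\<^sup>2 - 2 * q\<^sup>2 - p\<^sup>2" using assms(3) by algebra
  have pq: "p\<^sup>2 \<le> q\<^sup>2" "q\<^sup>2 > 0" "q\<^sup>2 \<le> p * q\<^sup>2" using assms by (auto intro: power_mono)
  have strict: "3 * p * q\<^sup>2 - 2 * q\<^sup>2 - p\<^sup>2 > 0"
  proof (cases "p = 1")
    case True
    have "q * q > 1 * 1" using assms by (intro mult_strict_mono) auto
    then show ?thesis using True by (simp add: power2_eq_square)
  next
    case False
    then have "2 * q\<^sup>2 \<le> p * q\<^sup>2" using assms by (intro mult_right_mono) auto
    then show ?thesis using pq by linarith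
  qed
  then have pos: "(r - q) * (q - (3 * p * q - r)) > 0" using f by simp
  then show "q < r" using assms by (cases "q = r") auto
  then show "3 * p * q - r \<le> q" using pos by (simp add: zero_less_mult_iff)
  show "p\<^sup>2 + (3 * p * q - r)\<^sup>2 + q\<^sup>2 = 3 * p * (3 * p * q - r) * q" using assms(3) by algebra
qed

text \<open>Strong induction on the largest entry: the descent replaces r by the smaller root, and
  the resulting pair of vectors is lifted again by a Vieta step. The bound \<open>r > 1\<close>
  excludes (1, 1, 1), so the descent ends at (1, 1, 2).\<close>

lemma markoff_is_cohn:
  fixes p q r :: int
  assumes "p > 0" "q > 0" "p\<^sup>2 + q\<^sup>2 + r\<^sup>2 = 3 * p * q * r" "p \<le> r" "q \<le> r" "r > 1"
  shows "\<exists>a b c d. a * d = c * b + 1 \<and> {cohn a b, cohn c d} = {p, q} \<and> cohn (a + c) (b + d) = r"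
  using assms
proof (induction "nat r" arbitrary: p q r rule: less_induct)
  case less
  have *: "\<exists>a b c d. a * d = c * b + 1 \<and> {cohn a b, cohn c d} = {p, q} \<and> cohn (a + c) (b + d) = r"
    if h: "p > 0" "q > 0" "p\<^sup>2 + q\<^sup>2 + r\<^sup>2 = 3 * p * q * r" "p \<le> q" "q \<le> r" for p q
  proof (cases "q > 1")
    case False
    then have pq: "p = 1" "q = 1" using h by auto
    then have "(r - 1) * (r - 2) = 0" using h(3) by (simp add: power2_eq_square algebra_simps)
    then have "r = 2" using less.prems by auto
    then show ?thesis
      using pq cohn_1_0 cohn_0_1 cohn_1_1
      by (intro exI[of _ 1] exI[of _ 0] exI[of _ 0] exI[of _ 1]) simp
  next
    case True
    define r' where "r' = 3 * p * q - r"
    have r': "0 < r'" "r' \<le> q" "q < r" "p\<^sup>2 + r'\<^sup>2 + q\<^sup>2 = 3 * p * r' * q"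
      using markoff_descent[OF h True] by (simp_all add: r'_def)
    have "nat q < nat r" using True r' by simp
    from less.hyps[OF this h(1) r'(1,4) h(4) r'(2) True]
    obtain a b c d where abcd: "a * d = c * b + 1" "{cohn a b, cohn c d} = {p, r'}"
      "cohn (a + c) (b + d) = q" by blast
    then consider "cohn a b = p" "cohn c d = r'" | "cohn a b = r'" "cohn c d = p"
      by (auto simp: doubleton_eq_iff)
    then show ?thesis
    proof cases
      \<comment> \<open>The vector with value p is kept, and the one with value \<open>r'\<close>
        gives way to the sum, of value q; the new sum then has value 3 p q - r' = r.\<close>
      case 1
      have "cohn (a + (a + c)) (b + (b + d)) = r"
        using cohn_vieta(1)[OF abcd(1)] 1 abcd(3) by (simp add: r'_def)
      moreover have "a * (b + d) = (a + c) * b + 1" using abcd(1) by (simp add: algebra_simps)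
      ultimately show ?thesis using 1 abcd(3) by blast
    next
      case 2
      have "cohn (a + c + c) (b + d + d) = r"
        using cohn_vieta(2)[OF abcd(1)] 2 abcd(3) by (simp add: r'_def)
      moreover have "(a + c) * d = c * (b + d) + 1" using abcd(1) by (simp add: algebra_simps)
      moreover have "{cohn (a + c) (b + d), cohn c d} = {p, q}" using 2 abcd(3) by auto
      ultimately show ?thesis by blast
    qed
  qed
  show ?case
  proof (cases "p \<le> q")
    case True
    then show ?thesis using *[of p q] less.prems by simp
  next
    case False
    have "q\<^sup>2 + p\<^sup>2 + r\<^sup>2 = 3 * q * p * r" using less.prems(3) by (simp add: algebra_simps)
    then show ?thesis using *[of q p] False less.prems by (simp add: insert_commute)
  qed
qed

lemma superbase_swap:
  assumes "lax_superbase L {a, b, c}"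
  shows "lax_superbase L {b, a, c}" "lax_superbase L {a, c, b}"
  using assms by (simp_all only: insert_commute)

lemma markoff_arises_max:
  assumes m: "markoff_triple x y z" and "x \<le> z" "y \<le> z"
  shows "\<exists>u v w. lax_superbase tri_lattice {lax u, lax v, lax w} \<and>
    matching_number u = x \<and> matching_number v = y \<and> matching_number w = z"
proof -
  obtain e f where s: "sector e f" using sector_base by blast
  show ?thesis
  proof (cases "z > 1")
    case False
    then have xyz: "x = 1" "y = 1" "z = 1" using assms by (auto simp: markoff_triple_def)
    \<comment> \<open>The exceptional triple (1, 1, 1) is realized by e, -f and e - f, all of them
      shortest.\<close>
    have hex: "(1, 0) \<in> hexagon" "(0, - 1) \<in> hexagon" "(1, - 1) \<in> hexagon" by (auto simp: hexagon_def)
    have "lax_superbase tri_lattice {lax (lattice_point e f (1, 0)), lax (lattice_point e f (0, - 1)),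
        lax (lattice_point e f ((1, 0) + (0, - 1)))}"
      by (rule lax_superbase_lat[OF s]) (simp add: det2_def)
    moreover have "matching_number (lattice_point e f c) = 1" if "c \<in> hexagon" for c
      using that s by (simp add: matching_number_def sector_def)
    ultimately show ?thesis using hex xyz by (metis add_Pair add_0 add.right_neutral)
  next
    case True
    obtain a b c d where abcd: "a * d = c * b + 1" "{cohn a b, cohn c d} = {int x, int y}"
      "cohn (a + c) (b + d) = int z"
      using markoff_is_cohn[of "int x" "int y" "int z"] m True assms(2,3)
      unfolding markoff_triple_int by auto
    let ?U = "lattice_point e f (int a, int b)" and ?V = "lattice_point e f (int c, int d)"
    let ?W = "lattice_point e f ((int a, int b) + (int c, int d))"
    have uni: "unimodular a b c d" using abcd(1) by (simp add: unimodular_iff)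
    then have sup: "lax_superbase tri_lattice {lax ?U, lax ?V, lax ?W}"
      by (intro lax_superbase_lat[OF s]) (simp add: unimodular_def)
    have det: "\<bar>det2 (int a, int b) (int c, int d)\<bar> = 1" "\<bar>det2 (int c, int d) (int a, int b)\<bar> = 1"
      "\<bar>det2 (int (a + c), int (b + d)) (int a, int b)\<bar> = 1"
      using uni by (auto simp: unimodular_def det2_def algebra_simps abs_minus_commute)
    have "coprime a b" "coprime c d" "coprime (a + c) (b + d)"
      using coprime_of_det2[OF det(1)] coprime_of_det2[OF det(2)] coprime_of_det2[OF det(3)]
      by (simp_all only: fst_conv snd_conv coprime_int_iff)
    note M = this[THEN matching_number_pt[OF s]]
    have "matching_number ?W = z" using M(3) abcd(3) by simp
    moreover have "matching_number ?U = x \<and> matching_number ?V = y \<or> matching_number ?U = y \<and> matching_number ?V = x"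
      using M(1,2) abcd(2) by (auto simp: doubleton_eq_iff)
    moreover note sup superbase_swap(1)[OF sup]
    ultimately show ?thesis by blast
  qed
qed

lemma markoff_arises:
  assumes "markoff_triple x y z"
  shows "\<exists>u v w. lax_superbase tri_lattice {lax u, lax v, lax w} \<and>
    matching_number u = x \<and> matching_number v = y \<and> matching_number w = z"
proof -
  consider "x \<le> z" "y \<le> z" | "x \<le> y" "z \<le> y" | "y \<le> x" "z \<le> x" by linarith
  then show ?thesis
  proof cases
    case 1
    then show ?thesis using markoff_arises_max assms by blast
  next
    case 2
    from markoff_arises_max[OF markoff_triple_perm(2)[OF assms] 2]
    obtain u w v where "lax_superbase tri_lattice {lax u, lax w, lax v}"
      "matching_number u = x" "matching_number w = z" "matching_number v = y" by blast
    then show ?thesis using superbase_swap(2) by blast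
  next
    case 3
    from markoff_arises_max[OF markoff_triple_perm(2)[OF markoff_triple_perm(1)[OF assms]] 3]
    obtain v w u where S: "lax_superbase tri_lattice {lax v, lax w, lax u}"
      "matching_number v = y" "matching_number w = z" "matching_number u = x" by blast
    then show ?thesis using superbase_swap(1)[OF superbase_swap(2)[OF S(1)]] by blast
  qed
qed

text \<open>Bezout coefficients of the coprime coordinates complete the vector to a basis, hence to
  a superbase.\<close>

lemma markoff_number_matching_number:
  assumes "primitive_vector tri_lattice u"
  shows "markoff_number (matching_number u)"
proof -
  obtain e f where s: "sector e f" using sector_base by blast
  obtain x y where u: "u = lattice_point e f (x, y)"
    using assms sector_coordinates[OF s] unfolding primitive_vector_def by blast
  have "coprime x y" using assms primitive_iff[OF s] by (simp add: u)
  then obtain k l where "k * x + l * y = 1"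
    using bezout_int[of x y] by (auto simp: coprime_iff_gcd_eq_1)
  then have "\<bar>det2 (x, y) (- l, k)\<bar> = 1" by (simp add: det2_def algebra_simps)
  from markoff_superbase(1)[OF lax_superbase_lat[OF s this]] show ?thesis
    unfolding markoff_number_def u by (auto simp: markoff_triple_def)
qed

theorem theorem7p1:
  shows "(\<forall>u. primitive_vector tri_lattice u \<longrightarrow> matching_number (- u) = matching_number u) \<and>
    (\<forall>u v w. lax_superbase tri_lattice {lax u, lax v, lax w} \<longrightarrow>
       markoff_triple (matching_number u) (matching_number v) (matching_number w)) \<and>
    (\<forall>x y z. markoff_triple x y z \<longrightarrow>
       (\<exists>u v w. lax_superbase tri_lattice {lax u, lax v, lax w} \<and>
          matching_number u = x \<and> matching_number v = y \<and> matching_number w = z)) \<and>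
    (\<forall>u. primitive_vector tri_lattice u \<longrightarrow> markoff_number (matching_number u)) \<and>
    (\<forall>m. markoff_number m \<longrightarrow>
       (\<exists>u. primitive_vector tri_lattice u \<and> matching_number u = m))"
proof (intro conjI allI impI)
  fix m assume "markoff_number m"
  then obtain x y z where "markoff_triple x y z" "m \<in> {x, y, z}"
    by (auto simp: markoff_number_def)
  then obtain y' z' where "markoff_triple m y' z'"
    using markoff_triple_perm by (metis empty_iff insert_iff)
  then obtain u v w where "lax_superbase tri_lattice {lax u, lax v, lax w}" "matching_number u = m"
    using markoff_arises by blast
  then show "\<exists>u. primitive_vector tri_lattice u \<and> matching_number u = m"
    using markoff_superbase(2) by blast
qed (use matching_number_minus markoff_superbase(1) markoff_arises markoff_number_matching_number in auto)

end
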